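(* Let $G$ be a finite planar graph with no two intersecting triangles and such that every triangle of $G$ is adjacent to at most one $4$-cycle. Then $\mathrm{mad}(G)<4$.
   Context: A triangle is a $3$-cycle. Two cycles of a graph are adjacent if they share a common edge, and intersecting if they have at least one common vertex. The maximum average degree is $\mathrm{mad}(G)=\max\{2|E(H)|/|V(H)| : H \text{ a subgraph of } G\}$. *)

theory Defs
  imports "HOL-Analysis.Analysis"
begin

definition finite_simple_graph :: "'a set \<Rightarrow> 'a set set \<Rightarrow> bool" where
  "finite_simple_graph V E \<longleftrightarrow> finite V \<and> (\<forall>e\<in>E. e \<subseteq> V \<and> card e = 2)"

definition planar_graph :: "'a set \<Rightarrow> 'a set set \<Rightarrow> bool" where
  "planar_graph V E \<longleftrightarrow>
    (\<exists>(pos :: 'a \<Rightarrow> complex) (\<gamma> :: 'a set \<Rightarrow> real \<Rightarrow> complex).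
       inj_on pos V \<and>
       (\<forall>e\<in>E. arc (\<gamma> e) \<and> {pathstart (\<gamma> e), pathfinish (\<gamma> e)} = pos ` e \<and>
               path_image (\<gamma> e) \<inter> pos ` V = pos ` e) \<and>
       (\<forall>e\<in>E. \<forall>f\<in>E. e \<noteq> f \<longrightarrow>
               path_image (\<gamma> e) \<inter> path_image (\<gamma> f) = pos ` (e \<inter> f)))"

definition cycle_edges :: "'a list \<Rightarrow> 'a set set" where
  "cycle_edges vs = {{vs ! i, vs ! ((i + 1) mod length vs)} | i. i < length vs}"

definition is_cycle :: "'a set \<Rightarrow> 'a set set \<Rightarrow> nat \<Rightarrow> 'a set set \<Rightarrow> bool" where
  "is_cycle V E k C \<longleftrightarrow>
    (\<exists>vs. length vs = k \<and> k \<ge> 3 \<and> distinct vs \<and> set vs \<subseteq> V \<and>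
          C = cycle_edges vs \<and> C \<subseteq> E)"

abbreviation is_triangle :: "'a set \<Rightarrow> 'a set set \<Rightarrow> 'a set set \<Rightarrow> bool" where
  "is_triangle V E C \<equiv> is_cycle V E 3 C"

definition cycle_vertices :: "'a set set \<Rightarrow> 'a set" where
  "cycle_vertices C = \<Union>C"

definition adjacent_cycles :: "'a set set \<Rightarrow> 'a set set \<Rightarrow> bool" where
  "adjacent_cycles C D \<longleftrightarrow> C \<inter> D \<noteq> {}"

definition intersecting_cycles :: "'a set set \<Rightarrow> 'a set set \<Rightarrow> bool" where
  "intersecting_cycles C D \<longleftrightarrow> cycle_vertices C \<inter> cycle_vertices D \<noteq> {}"

definition mad :: "'a set \<Rightarrow> 'a set set \<Rightarrow> real" where
  "mad V E = Max {2 * real (card F) / real (card W) | W F.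
                   W \<subseteq> V \<and> W \<noteq> {} \<and> F \<subseteq> E \<and> (\<forall>e\<in>F. e \<subseteq> W)}"

end

theory Submission
  imports Defs
begin

text \<open>A subgraph with \<open>v \<ge> 2\<close> vertices has at most \<open>2v - 3\<close> edges, by induction on \<open>v\<close>. Vertices of
  degree at most two can be deleted. Otherwise take a maximal subgraph that arises from a cycle by
  adding ears. If some vertex lies outside it, the absence of further ears splits the graph at one
  vertex, and two bounds of the form \<open>2v - 3\<close> add up. Otherwise it is the whole graph. Each ear
  splits one face in two by the theta-curve form of the Jordan curve theorem, so all faces are
  bounded by cycles, every edge lies on two of them, and Euler's formula holds. Now give a
  face of length \<open>k\<close> the charge \<open>k - 4\<close>. Every triangular face shares at least two edges with faces of length
  at least five and receives one half over each; the edges over which a large face pays form a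
  matching, so it never pays more than its charge. Hence the total face charge is
  nonnegative, and Euler's formula gives at most \<open>2v - 4\<close> edges.\<close>

section \<open>Theta curves\<close>

text \<open>Discharging needs faces bounded by cycles, with every edge on two of them. An arbitrary
  plane graph offers neither, since cut vertices and bridges spoil both. The hypotheses pass to
  subgraphs, so the induction absorbs these cases, and the geometry is confined to a graph built by
  ears, along which the combinatorial properties of the faces are carried as an invariant. Minimum
  degree three excludes two faces that share two edges at a common vertex. This is used twice:
  against a triangle both of whose quadrilateral neighbours are the same 4-cycle, and against a
  large face that shares two edges with one triangle. The constant 3 is dictated by the induction. A
  single edge on two vertices allows no larger constant, and gluing two parts at a vertex works only
  from 2 upwards. So neither the 4 that discharging yields nor the 1 that would suffice for average
  degree below four could be carried along.\<close>

definition jordan_region :: "complex set \<Rightarrow> complex set \<Rightarrow> bool" where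
  "jordan_region R J \<longleftrightarrow> R = inside J \<or> R = outside J"

text \<open>Inside and outside are treated alike because the face that an ear divides may be the
  unbounded one. Openness will place the connected interior of an ear in a single region; the
  closure bound will place its ends on the boundary of that region.\<close>

lemma jordan_region_topology:
  assumes "simple_path c" "pathfinish c = pathstart c" "path_image c = J" "jordan_region R J"
  shows "open R" "closure R \<subseteq> R \<union> J"
proof -
  note JIO = Jordan_inside_outside[OF assms(1,2), unfolded assms(3)]
  show "open R"
    using assms(4) JIO by (auto simp: jordan_region_def)
  have "closed J" using assms(1,3) closed_path_image simple_path_imp_path by blast
  then show "closure R \<subseteq> R \<union> J"
    using assms(4) closure_inside_subset closure_outside_subset
    by (auto simp: jordan_region_def)
qed

lemma arcs_loop:
  assumes "arc c1" "arc c2" "pathstart c1 = a" "pathfinish c1 = b"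
    "pathstart c2 = a" "pathfinish c2 = b" "path_image c1 \<inter> path_image c2 = {a,b}"
  shows "simple_path (c1 +++ reversepath c2)"
    "pathfinish (c1 +++ reversepath c2) = pathstart (c1 +++ reversepath c2)"
    "path_image (c1 +++ reversepath c2) = path_image c1 \<union> path_image c2"
  using assms by (auto simp: simple_path_join_loop_eq arc_reversepath path_image_join)

text \<open>Here \<open>A1\<close>, \<open>A2\<close>, \<open>A\<close> stand for the three arcs of
  a theta curve, \<open>S\<close> for their common ends and the \<open>I\<close> sets for the
  insides. If \<open>A2\<close> cuts the inside of \<open>A1 \<union> A\<close>, then by
  complementation \<open>A\<close> cuts the outside of \<open>A1 \<union> A2\<close>. Pointwise this
  is propositional logic.\<close>

lemma outer_split_sets:
  assumes "I12 \<inter> I2 = {}" "I12 \<union> I2 \<union> (A2 - S) = I1"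
    "A1 \<inter> A2 = S" "A1 \<inter> A = S" "A2 \<inter> A = S" "I2 \<inter> (A2 \<union> A) = {}" "I1 \<inter> (A1 \<union> A) = {}"
    "A \<inter> I12 = {}"
  shows "- ((A1 \<union> A) \<union> I1) \<union> I2 \<union> (A - S) = - ((A1 \<union> A2) \<union> I12)"
proof (rule set_eqI)
  fix x
  have "x \<in> I1 \<longleftrightarrow> x \<in> I12 \<or> x \<in> I2 \<or> (x \<in> A2 \<and> x \<notin> S)" "x \<in> S \<longleftrightarrow> x \<in> A1 \<and> x \<in> A2"
    "x \<in> S \<longleftrightarrow> x \<in> A1 \<and> x \<in> A" "x \<in> S \<longleftrightarrow> x \<in> A2 \<and> x \<in> A" "\<not> (x \<in> I2 \<and> (x \<in> A2 \<or> x \<in> A))"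
    "\<not> (x \<in> I1 \<and> (x \<in> A1 \<or> x \<in> A))" "\<not> (x \<in> I12 \<and> x \<in> A)" "\<not> (x \<in> I12 \<and> x \<in> I2)"
    using assms by blast+
  then show "x \<in> - ((A1 \<union> A) \<union> I1) \<union> I2 \<union> (A - S) \<longleftrightarrow> x \<in> - ((A1 \<union> A2) \<union> I12)"
    unfolding Un_iff Compl_iff Diff_iff by argo
qed

locale theta_arcs =
  fixes c1 c2 c :: "real \<Rightarrow> complex" and a b :: complex
  assumes arcs: "arc c1" "arc c2" "arc c"
    and ends: "pathstart c1 = a" "pathfinish c1 = b" "pathstart c2 = a" "pathfinish c2 = b"
      "pathstart c = a" "pathfinish c = b"
    and meet: "path_image c1 \<inter> path_image c2 = {a,b}" "path_image c1 \<inter> path_image c = {a,b}"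
      "path_image c2 \<inter> path_image c = {a,b}"
begin

lemma distinct_ends: "a \<noteq> b"
  using arc_distinct_ends[OF arcs(1)] ends by auto

lemma arc_interior_ne:
  "path_image c1 - {a,b} \<noteq> {}" "path_image c2 - {a,b} \<noteq> {}" "path_image c - {a,b} \<noteq> {}"
  using nonempty_simple_path_endless arcs ends arc_imp_simple_path by metis+

abbreviation "I12 \<equiv> inside (path_image c1 \<union> path_image c2)"
abbreviation "I1 \<equiv> inside (path_image c1 \<union> path_image c)"
abbreviation "I2 \<equiv> inside (path_image c2 \<union> path_image c)"

text \<open>If no arc were inside the curve formed by the other two, a point of \<open>I2\<close> could be joined to infinity
  avoiding \<open>c1 \<union> c2\<close> and avoiding \<open>c1 \<union> c\<close>. These two sets meet in the connected set \<open>c1\<close>, so by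
  Janiszewski's theorem it could be joined to infinity avoiding all three arcs.\<close>

lemma some_arc_inside:
  "path_image c \<inter> I12 \<noteq> {} \<or> path_image c2 \<inter> I1 \<noteq> {} \<or> path_image c1 \<inter> I2 \<noteq> {}"
proof (rule ccontr)
  assume "\<not> ?thesis"
  then have dis: "path_image c \<inter> I12 = {}" "path_image c2 \<inter> I1 = {}" "path_image c1 \<inter> I2 = {}"
    by auto
  note l12 = arcs_loop[OF arcs(1,2) ends(1-4) meet(1)]
  note l1 = arcs_loop[OF arcs(1,3) ends(1,2,5,6) meet(2)]
  note l2 = arcs_loop[OF arcs(2,3) ends(3-6) meet(3)]
  note j12 = Jordan_inside_outside[OF l12(1,2), unfolded l12(3)]
  note j1 = Jordan_inside_outside[OF l1(1,2), unfolded l1(3)]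
  note j2 = Jordan_inside_outside[OF l2(1,2), unfolded l2(3)]
  let ?\<Theta> = "path_image c1 \<union> path_image c2 \<union> path_image c"
  \<comment> \<open>A connected set that misses the curve \<open>K\<close> lies on one side of it,
    and a common point decides which.\<close>
  have absorb: "inside K' \<subseteq> inside K"
    if "connected (inside K')" "inside K \<inter> inside K' \<noteq> {}" "K \<inter> inside K' = {}"
      "inside K \<union> outside K = - K" "open (inside K)" "open (outside K)" "inside K \<inter> outside K = {}"
    for K K' :: "complex set"
    using connectedD[OF that(1) that(5,6)] that by blast
  have ne: "I12 \<inter> I2 = {}"
  proof (rule ccontr)
    assume "I12 \<inter> I2 \<noteq> {}"
    moreover have "(path_image c1 \<union> path_image c2) \<inter> I2 = {}"
      using dis inside_no_overlap[of "path_image c2 \<union> path_image c"] by blast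
    moreover have "(path_image c2 \<union> path_image c) \<inter> I12 = {}"
      using dis inside_no_overlap[of "path_image c1 \<union> path_image c2"] by blast
    ultimately have "I12 \<subseteq> I2" "I2 \<subseteq> I12"
      using j12 j2 by (intro absorb; simp add: Int_commute)+
    then have "I12 = I2" by (rule subset_antisym)
    \<comment> \<open>A Jordan curve is the frontier of its inside, so equal insides force equal
      curves.\<close>
    then have "path_image c1 \<union> path_image c2 = path_image c2 \<union> path_image c"
      using j12 j2 by metis
    then show False using arc_interior_ne(1) meet by blast
  qed
  have ne1: "I1 \<inter> I2 = {}"
  proof (rule ccontr)
    assume "I1 \<inter> I2 \<noteq> {}"
    moreover have "(path_image c1 \<union> path_image c) \<inter> I2 = {}"
      using dis inside_no_overlap[of "path_image c2 \<union> path_image c"] by blast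
    moreover have "(path_image c2 \<union> path_image c) \<inter> I1 = {}"
      using dis inside_no_overlap[of "path_image c1 \<union> path_image c"] by blast
    ultimately have "I1 \<subseteq> I2" "I2 \<subseteq> I1"
      using j1 j2 by (intro absorb; simp add: Int_commute)+
    then have "I1 = I2" by (rule subset_antisym)
    then have "path_image c1 \<union> path_image c = path_image c2 \<union> path_image c"
      using j1 j2 by metis
    then show False using arc_interior_ne(1) meet by blast
  qed
  obtain x where x: "x \<in> I2" using j2 by blast
  have "bounded ?\<Theta>" by (simp add: arcs bounded_arc_image)
  then have "\<not> bounded (outside ?\<Theta>)"
    by (metis bounded_path_image arcs arc_imp_path bounded_Un unbounded_outside)
  then obtain o' where o': "o' \<in> outside ?\<Theta>"
    by (metis bounded_empty ex_in_conv)
  have out: "o' \<in> outside (path_image c1 \<union> path_image c2)" "o' \<in> outside (path_image c1 \<union> path_image c)"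
    "o' \<in> outside (path_image c2 \<union> path_image c)"
    using o' outside_mono[of "path_image c1 \<union> path_image c2" ?\<Theta>] outside_mono[of "path_image c1 \<union> path_image c" ?\<Theta>]
      outside_mono[of "path_image c2 \<union> path_image c" ?\<Theta>] by blast+
  have cc: "connected_component (- K) x o'"
    if "x \<in> outside K" "o' \<in> outside K" "connected (outside K)" for K
    using that outside_no_overlap[of K] unfolding connected_component_def
    by blast
  have xn: "x \<notin> path_image c1" "x \<notin> path_image c2" "x \<notin> path_image c"
    using x dis(3) inside_no_overlap[of "path_image c2 \<union> path_image c"] by blast+
  have "x \<in> I12 \<union> outside (path_image c1 \<union> path_image c2)"
    using xn by (simp add: inside_Un_outside)
  then have "x \<in> outside (path_image c1 \<union> path_image c2)"
    using x ne by blast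
  then have A: "connected_component (- (path_image c1 \<union> path_image c2)) x o'"
    using out(1) j12 by (intro cc) simp_all
  have "x \<in> I1 \<union> outside (path_image c1 \<union> path_image c)"
    using xn by (simp add: inside_Un_outside)
  then have "x \<in> outside (path_image c1 \<union> path_image c)"
    using x ne1 by blast
  then have B: "connected_component (- (path_image c1 \<union> path_image c)) x o'"
    using out(2) j1 by (intro cc) simp_all
  have "(path_image c1 \<union> path_image c2) \<inter> (path_image c1 \<union> path_image c) = path_image c1"
    using meet by blast
  then have "connected_component (- ((path_image c1 \<union> path_image c2) \<union> (path_image c1 \<union> path_image c))) x o'"
    using arcs by (intro Janiszewski_weak A B) (auto simp: compact_Un compact_arc_image connected_arc_image)
  then have "connected_component (- (path_image c2 \<union> path_image c)) x o'"
    by (rule connected_component_of_subset) auto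
  then have "o' \<in> I2"
    using x inside_same_component by blast
  then show False using out(3) inside_Int_outside by blast
qed

text \<open>Some arc runs inside the curve formed by the other two. If it is \<open>c\<close>, then
  \<open>R\<close> is the inside and is cut directly. Otherwise \<open>R\<close> is the outside, and
  the cut of the inside made by \<open>c1\<close> or \<open>c2\<close> is rearranged by
  \<open>outer_split_sets\<close>.\<close>

lemma region_split:
  assumes "jordan_region R (path_image c1 \<union> path_image c2)" "path_image c - {a,b} \<subseteq> R"
  obtains R1 R2 where "jordan_region R1 (path_image c1 \<union> path_image c)"
    "jordan_region R2 (path_image c2 \<union> path_image c)"
    "R1 \<inter> R2 = {}" "R1 \<union> R2 \<union> (path_image c - {a,b}) = R"
proof -
  note sp = arcs[THEN arc_imp_simple_path]
  show thesis
  proof (cases "path_image c \<inter> I12 = {}")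
    case False
    show thesis
    proof (rule split_inside_simple_closed_curve[OF sp(1) ends(1,2) sp(2) ends(3,4) sp(3) ends(5,6)
          distinct_ends meet False])
      assume *: "I1 \<inter> I2 = {}" "I1 \<union> I2 \<union> (path_image c - {a,b}) = I12"
      have "R = I12"
        using assms arc_interior_ne(3) inside_Int_outside[of "path_image c1 \<union> path_image c2"] *
        unfolding jordan_region_def by blast
      with * show thesis by (intro that[of I1 I2]) (auto simp: jordan_region_def)
    qed
  next
    case True
    have R: "R = outside (path_image c1 \<union> path_image c2)"
      using assms True arc_interior_ne(3) by (auto simp: jordan_region_def)
    have out: "outside K = - (K \<union> inside K)" for K :: "complex set"
      using union_with_inside by blast
    have "path_image c2 \<inter> I1 \<noteq> {} \<or> path_image c1 \<inter> I2 \<noteq> {}"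
      using True some_arc_inside by blast
    then show thesis
    proof
      assume ne: "path_image c2 \<inter> I1 \<noteq> {}"
      show thesis
      proof (rule split_inside_simple_closed_curve[OF sp(1) ends(1,2) sp(3) ends(5,6) sp(2) ends(3,4)
          distinct_ends meet(2,1) _ ne])
        show "path_image c \<inter> path_image c2 = {a,b}" using meet by auto
        assume *: "I12 \<inter> inside (path_image c \<union> path_image c2) = {}"
          "I12 \<union> inside (path_image c \<union> path_image c2) \<union> (path_image c2 - {a,b}) = I1"
        then have *: "I12 \<inter> I2 = {}" "I12 \<union> I2 \<union> (path_image c2 - {a,b}) = I1"
          by (simp_all add: Un_commute)
        show thesis
        proof (rule that[of "outside (path_image c1 \<union> path_image c)" I2])
          show "outside (path_image c1 \<union> path_image c) \<inter> I2 = {}"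
            using * unfolding out by blast
          show "outside (path_image c1 \<union> path_image c) \<union> I2 \<union> (path_image c - {a,b}) = R"
            unfolding R out
            using outer_split_sets[OF * meet inside_no_overlap inside_no_overlap True] .
        qed (auto simp: jordan_region_def)
      qed
    next
      assume ne: "path_image c1 \<inter> I2 \<noteq> {}"
      show thesis
      proof (rule split_inside_simple_closed_curve[OF sp(2) ends(3,4) sp(3) ends(5,6) sp(1) ends(1,2)
          distinct_ends meet(3) _ _ ne])
        show "path_image c \<inter> path_image c1 = {a,b}" "path_image c2 \<inter> path_image c1 = {a,b}" using meet by auto
        assume *: "inside (path_image c2 \<union> path_image c1) \<inter> inside (path_image c \<union> path_image c1) = {}"
          "inside (path_image c2 \<union> path_image c1) \<union> inside (path_image c \<union> path_image c1) \<union> (path_image c1 - {a,b}) = I2"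
        then have *: "I12 \<inter> I1 = {}" "I12 \<union> I1 \<union> (path_image c1 - {a,b}) = I2"
          by (simp_all add: Un_commute)
        show thesis
        proof (rule that[of I1 "outside (path_image c2 \<union> path_image c)"])
          show "I1 \<inter> outside (path_image c2 \<union> path_image c) = {}"
            using * unfolding out by blast
          show "I1 \<union> outside (path_image c2 \<union> path_image c) \<union> (path_image c - {a,b}) = R"
            unfolding R out
            using outer_split_sets[OF * _ meet(3,2) inside_no_overlap inside_no_overlap True] meet(1)
            by (simp add: Int_commute Un_commute)
        qed (auto simp: jordan_region_def)
      qed
    qed
  qed
qed

end

text \<open>Continuity sends the closure of the open parameter interval into the closure of its
  image. Thus the ends of an ear are limits of points of the face that contains its
  interior.\<close>

lemma arc_ends_in_closure:
  fixes g :: "real \<Rightarrow> complex"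
  assumes "arc g"
  shows "{pathstart g, pathfinish g} \<subseteq> closure (path_image g - {pathstart g, pathfinish g})"
proof -
  have "path_image g - {pathstart g, pathfinish g} = g ` {0<..<1}"
    using assms by (metis arc_imp_simple_path simple_path_endless)
  moreover have "g ` closure {0<..<1} \<subseteq> closure (g ` {0<..<1})"
    using assms by (intro image_closure_subset closure_subset)
      (auto simp: arc_def path_def closure_greaterThanLessThan)
  ultimately show ?thesis
    by (auto simp: pathstart_def pathfinish_def image_subset_iff)
qed

section \<open>Face structures and ears\<close>

fun path_edges :: "'a list \<Rightarrow> 'a set set" where
  "path_edges (x # y # zs) = insert {x, y} (path_edges (y # zs))"
| "path_edges _ = {}"

lemma path_edges_nth: "path_edges ws = {{ws ! i, ws ! Suc i} | i. Suc i < length ws}"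
proof (induction ws rule: path_edges.induct)
  case (1 x y zs)
  have "{{(x # y # zs) ! i, (x # y # zs) ! Suc i} | i. Suc i < length (x # y # zs)} =
    insert {x, y} {{(y # zs) ! i, (y # zs) ! Suc i} | i. Suc i < length (y # zs)}"
    (is "?L = ?R")
  proof (rule equalityI; rule subsetI)
    fix e assume "e \<in> ?L"
    then obtain i where "e = {(x # y # zs) ! i, (x # y # zs) ! Suc i}" "Suc i < length (x # y # zs)"
      by blast
    then show "e \<in> ?R" by (cases i) auto
  next
    fix e assume "e \<in> ?R"
    then consider "e = {x, y}" | i where "e = {(y # zs) ! i, (y # zs) ! Suc i}" "Suc i < length (y # zs)"
      by blast
    then show "e \<in> ?L"
    proof cases
      case 1 then show ?thesis by (intro CollectI exI[of _ 0]) auto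
    next
      case (2 i) then show ?thesis by (intro CollectI exI[of _ "Suc i"]) auto
    qed
  qed
  with 1 show ?case by simp
qed auto

lemma path_edges_append: "path_edges (xs @ y # ys) = path_edges (xs @ [y]) \<union> path_edges (y # ys)"
proof (induction xs)
  case (Cons x xs) then show ?case by (cases xs) auto
qed auto

lemma path_edges_rev: "path_edges (rev xs) = path_edges xs"
proof (induction xs rule: path_edges.induct)
  case (1 x y zs)
  have "path_edges (rev (x # y # zs)) = path_edges (rev zs @ y # [x])" by simp
  also have "\<dots> = path_edges (rev (y # zs)) \<union> {{y, x}}" by (subst path_edges_append) simp
  finally show ?case using 1 by (auto simp: insert_commute)
qed auto

lemma path_edges_subset: "e \<in> path_edges ws \<Longrightarrow> e \<subseteq> set ws"
  by (induction ws rule: path_edges.induct) auto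

lemma Union_path_edges: "length ws \<ge> 2 \<Longrightarrow> \<Union> (path_edges ws) = set ws"
proof (induction ws rule: path_edges.induct)
  case (1 x y zs) then show ?case by (cases zs) auto
qed auto

lemma finite_path_edges: "finite (path_edges ws)"
  by (induction ws rule: path_edges.induct) auto

lemma card_path_edges: "distinct ws \<Longrightarrow> card (path_edges ws) = length ws - 1"
proof (induction ws rule: path_edges.induct)
  case (1 x y zs)
  have "{x, y} \<notin> path_edges (y # zs)" using 1(2) path_edges_subset[of "{x,y}" "y # zs"] by auto
  then show ?case using 1 by (simp add: finite_path_edges)
qed auto

lemma path_edges_card2: "distinct ws \<Longrightarrow> e \<in> path_edges ws \<Longrightarrow> card e = 2"
  by (induction ws rule: path_edges.induct) auto

lemma path_edges_hd:
  assumes "distinct (x # zs)" "e \<in> path_edges (x # zs)" "x \<in> e"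
  shows "e = {x, hd zs}"
proof (cases zs)
  case (Cons y ys) 
  then show ?thesis using assms path_edges_subset[of e "y # ys"] by auto
qed (use assms in auto)

text \<open>Together with \<open>path_edges_end_unique\<close> this supplies the degree conditions
  that \<open>facial_ear\<close> imposes on an ear.\<close>

lemma path_edges_at_most_two:
  assumes "distinct ws" "x \<in> path_edges ws" "y \<in> path_edges ws" "z \<in> path_edges ws"
    "v \<in> x" "v \<in> y" "v \<in> z"
  shows "x = y \<or> y = z \<or> x = z"
  using assms
proof (induction ws rule: path_edges.induct)
  case (1 p q zs)
  have *: "e = {p, q} \<or> e = {q, hd zs}" if "e \<in> path_edges (p # q # zs)" "v \<in> e" "v = p \<or> v = q" for e
    using that 1(2) path_edges_hd[of q zs e] path_edges_subset[of e "q # zs"] by auto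
  show ?case
  proof (cases "v = p \<or> v = q")
    case True then show ?thesis using *[of x] *[of y] *[of z] 1 by metis
  next
    case False then show ?thesis using 1 by auto
  qed
qed auto

lemma path_edges_end_unique:
  assumes "distinct (a # p @ [b])" "x \<in> path_edges (a # p @ [b])" "y \<in> path_edges (a # p @ [b])"
    "v \<in> x" "v \<in> y" "v = a \<or> v = b"
  shows "x = y"
  using assms(6)
proof
  assume "v = a" then show ?thesis
    using path_edges_hd[of a "p @ [b]"] assms by metis
next
  assume "v = b" then show ?thesis
    using path_edges_hd[of b "rev p @ [a]" x] path_edges_hd[of b "rev p @ [a]" y]
      assms path_edges_rev[of "a # p @ [b]"]
    by auto
qed

text \<open>Repeating the first vertex at the end removes the modular index, so facts about paths
  carry over to cycles.\<close>

lemma cycle_edges_Cons: "cycle_edges (x # xs) = path_edges (x # xs @ [x])"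
proof -
  let ?vs = "x # xs"
  have "{?vs ! i, ?vs ! ((i + 1) mod length ?vs)} = {(?vs @ [x]) ! i, (?vs @ [x]) ! Suc i}"
    if "i < length ?vs" for i
  proof (cases "Suc i = length ?vs")
    case True then show ?thesis by (auto simp: nth_append nth_Cons')
  next
    case False
    with that have "Suc i < length ?vs" by simp
    then have "(?vs @ [x]) ! i = ?vs ! i" "(?vs @ [x]) ! Suc i = ?vs ! Suc i"
      using that by (simp_all only: nth_append if_True)
    then show ?thesis using \<open>Suc i < length ?vs\<close> by simp
  qed
  then show ?thesis
    unfolding cycle_edges_def path_edges_nth by (auto; metis)
qed

lemma cycle_edges_rotate: "cycle_edges (xs @ v # ys) = cycle_edges (v # ys @ xs)"
proof (cases xs)
  case (Cons x zs)
  have "cycle_edges (xs @ v # ys) = path_edges ((x # zs) @ v # (ys @ [x]))"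
    using Cons cycle_edges_Cons[of x "zs @ v # ys"] by simp
  also have "\<dots> = path_edges (x # zs @ [v]) \<union> path_edges (v # ys @ [x])"
    by (subst path_edges_append) simp
  also have "\<dots> = path_edges ((v # ys) @ x # (zs @ [v]))"
    by (subst path_edges_append[of "v # ys"]) auto
  also have "\<dots> = cycle_edges (v # ys @ xs)"
    using Cons cycle_edges_Cons[of v "ys @ xs"] by simp
  finally show ?thesis .
qed simp

lemma cycle_edges_two:
  "cycle_edges (a # xs @ b # ys) = path_edges (a # xs @ [b]) \<union> path_edges (b # ys @ [a])"
  using cycle_edges_Cons[of a "xs @ b # ys"] path_edges_append[of "a # xs" b "ys @ [a]"] by simp

text \<open>Both halves run from \<open>a\<close> to \<open>b\<close>, the form in which they become
  two arcs of a theta curve.\<close>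

lemma cycle_edges_two_rev:
  "cycle_edges (a # xs @ b # rev ys) = path_edges (a # xs @ [b]) \<union> path_edges (a # ys @ [b])"
  using cycle_edges_two[of a xs b "rev ys"] path_edges_rev[of "a # ys @ [b]"] by simp

lemma cycle_split_at:
  assumes "distinct vs" "a \<in> set vs" "b \<in> set vs" "a \<noteq> b"
  obtains xs ys where "distinct (a # xs @ b # ys)" "cycle_edges vs = cycle_edges (a # xs @ b # ys)"
    "set vs = set (a # xs @ b # ys)" "length vs = length (a # xs @ b # ys)"
proof -
  obtain us ws where 1: "vs = us @ a # ws" using assms by (meson split_list)
  then have "b \<in> set (ws @ us)" using assms by auto
  then obtain xs ys where 2: "ws @ us = xs @ b # ys" by (meson split_list)
  have "cycle_edges vs = cycle_edges (a # ws @ us)" using 1 by (simp add: cycle_edges_rotate)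
  moreover have "mset vs = mset (a # ws @ us)" using 1 by simp
  ultimately show thesis using 2 assms(1) that[of xs ys]
    by (metis mset_eq_imp_distinct_iff mset_eq_length mset_eq_setD)
qed

lemma Union_cycle_edges: "length vs \<ge> 2 \<Longrightarrow> \<Union> (cycle_edges vs) = set vs"
  using Union_path_edges[of "hd vs # tl vs @ [hd vs]"] cycle_edges_Cons[of "hd vs" "tl vs"]
  by (cases vs) auto

lemma finite_cycle_edges: "finite (cycle_edges vs)"
  by (cases vs) (auto simp: cycle_edges_Cons finite_path_edges, simp add: cycle_edges_def)

lemma cycle_edges_snoc:
  "cycle_edges (x # xs @ [y]) = insert {x, y} (path_edges (x # xs @ [y]))"
  using cycle_edges_two[of x xs y "[]"] by (auto simp: insert_commute)

lemma card_cycle_edges: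
  assumes "distinct vs" "length vs \<ge> 3"
  shows "card (cycle_edges vs) = length vs"
proof -
  obtain x z ws where "vs = x # z # ws" "ws \<noteq> []"
    using assms(2) by (cases vs; cases "tl vs"; cases "tl (tl vs)") auto
  then obtain xs y where vs: "vs = x # xs @ [y]" "xs \<noteq> []"
    by (metis append_Cons append_butlast_last_id list.distinct(1))
  have "{x, y} \<notin> path_edges (x # xs @ [y])"
  proof
    assume "{x, y} \<in> path_edges (x # xs @ [y])"
    then have "{x, y} = {x, hd (xs @ [y])}" using path_edges_hd[of x "xs @ [y]" "{x,y}"] assms vs by auto
    then show False using vs assms(1) by (auto simp: doubleton_eq_iff)
  qed
  then show ?thesis using vs assms card_path_edges[of vs] finite_path_edges[of vs] cycle_edges_snoc[of x xs y] by simp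
qed

lemma cycle_at_vertex:
  assumes "distinct vs" "length vs \<ge> 3" "v \<in> set vs"
  obtains x y where "x \<noteq> y" "x \<in> cycle_edges vs" "y \<in> cycle_edges vs" "v \<in> x" "v \<in> y"
    "\<And>e. e \<in> cycle_edges vs \<Longrightarrow> v \<in> e \<Longrightarrow> e = x \<or> e = y"
proof -
  obtain us ws where 1: "vs = us @ v # ws" using assms by (meson split_list)
  let ?zs = "ws @ us"
  have 2: "cycle_edges vs = cycle_edges (v # ?zs)" using 1 by (simp add: cycle_edges_rotate)
  have d: "distinct (v # ?zs)" "length ?zs \<ge> 2" using 1 assms by auto
  then have "?zs \<noteq> []" by auto
  then obtain xs y where zs: "?zs = xs @ [y]" by (metis append_butlast_last_id)
  with d have ne: "xs \<noteq> []" by auto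
  have 3: "cycle_edges vs = insert {v, y} (path_edges (v # xs @ [y]))"
    using 2 zs cycle_edges_snoc[of v xs y] by simp
  show thesis
  proof (rule that[of "{v, y}" "{v, hd xs}"])
    show "{v, y} \<noteq> {v, hd xs}" using d zs ne by (auto simp: doubleton_eq_iff)
    show "{v, hd xs} \<in> cycle_edges vs" using 3 ne by (cases xs) auto
    show "e = {v, y} \<or> e = {v, hd xs}" if "e \<in> cycle_edges vs" "v \<in> e" for e
      using that 3 path_edges_hd[of v "xs @ [y]" e] d zs ne by auto
  qed (auto simp: 3)
qed

lemma is_cycleE:
  assumes "is_cycle V E k C"
  obtains vs where "length vs = k" "k \<ge> 3" "distinct vs" "set vs \<subseteq> V" "C = cycle_edges vs"
    "C \<subseteq> E" "\<Union> C = set vs" "card C = k" "finite C"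
proof -
  obtain vs where vs: "length vs = k" "k \<ge> 3" "distinct vs" "set vs \<subseteq> V" "C = cycle_edges vs" "C \<subseteq> E"
    using assms unfolding is_cycle_def by blast
  show thesis
    using vs Union_cycle_edges[of vs] card_cycle_edges[of vs] finite_cycle_edges[of vs]
    by (intro that[of vs]) auto
qed

lemma is_cycle_mono:
  assumes "is_cycle V E k C" "V \<subseteq> V'" "E \<subseteq> E'"
  shows "is_cycle V' E' k C"
  using assms unfolding is_cycle_def by blast

text \<open>A face is a pair of an arbitrary label (later its region of the plane) and its boundary, so that
  distinct faces may have the same boundary. Condition \<open>shared_corner\<close> is all that
  is needed of the fact that the faces around a vertex form a single cycle.\<close>

locale facial =
  fixes W :: "'a set" and F :: "'a set set" and \<Phi> :: "('f \<times> 'a set set) set"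
  assumes finite_faces: "finite \<Phi>" and faces_nonempty: "\<Phi> \<noteq> {}"
    and finite_edges: "finite F"
    and vertices: "W = \<Union> F"
    and finite_vertices: "finite W"
    and face_cycle: "\<phi> \<in> \<Phi> \<Longrightarrow> \<exists>k. is_cycle W F k (snd \<phi>)"
    and two_faces: "e \<in> F \<Longrightarrow> card {\<phi>\<in>\<Phi>. e \<in> snd \<phi>} = 2"
    and euler: "card \<Phi> + card W = card F + 2"
    and shared_corner: "\<lbrakk>\<phi> \<in> \<Phi>; \<psi> \<in> \<Phi>; \<phi> \<noteq> \<psi>; x \<noteq> y; v \<in> x; v \<in> y; x \<in> snd \<phi>; y \<in> snd \<phi>;
      x \<in> snd \<psi>; y \<in> snd \<psi>; e \<in> F; v \<in> e\<rbrakk> \<Longrightarrow> e = x \<or> e = y"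
begin

lemma face_subset: "\<phi> \<in> \<Phi> \<Longrightarrow> snd \<phi> \<subseteq> F"
  using face_cycle unfolding is_cycle_def by blast

lemma card_vertices_ge_3: "card W \<ge> 3"
proof -
  obtain \<phi> where "\<phi> \<in> \<Phi>" using faces_nonempty by blast
  then obtain k where "is_cycle W F k (snd \<phi>)" using face_cycle by blast
  then obtain vs where "length vs \<ge> 3" "distinct vs" "set vs \<subseteq> W" by (elim is_cycleE) auto
  then show ?thesis using card_mono[OF finite_vertices, of "set vs"] distinct_card[of vs] by simp
qed

end

lemma facial_two:
  assumes "facial W F \<Phi>" "e \<in> F"
  obtains \<phi> \<psi> where "\<phi> \<noteq> \<psi>" "{\<rho>\<in>\<Phi>. e \<in> snd \<rho>} = {\<phi>, \<psi>}"
  using facial.two_faces[OF assms] by (meson card_2_iff)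

lemma facial_not_three:
  assumes "facial W F \<Phi>" "e \<in> F" "\<phi> \<in> \<Phi>" "\<psi> \<in> \<Phi>" "\<rho> \<in> \<Phi>" "e \<in> snd \<phi>" "e \<in> snd \<psi>" "e \<in> snd \<rho>"
  shows "\<phi> = \<psi> \<or> \<psi> = \<rho> \<or> \<phi> = \<rho>"
proof -
  obtain p q where "{\<rho>\<in>\<Phi>. e \<in> snd \<rho>} = {p, q}" using facial_two[OF assms(1,2)] by metis
  then have "\<phi> \<in> {p,q}" "\<psi> \<in> {p,q}" "\<rho> \<in> {p,q}" using assms by auto
  then show ?thesis by auto
qed

text \<open>Start of the ear construction. The labels keep the two sides of the cycle apart although
  their boundaries agree. Euler's formula reads 2 + n = n + 2, and \<open>shared_corner\<close>
  holds because each vertex has only two edges.\<close>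

lemma facial_cycle:
  assumes vs: "distinct vs" "length vs \<ge> 3" "C = cycle_edges vs" and "R1 \<noteq> R2"
  shows "facial (\<Union> C) C {(R1, C), (R2, C)}"
proof -
  have W: "\<Union> C = set vs" using Union_cycle_edges[of vs] vs by simp
  have cyc: "is_cycle (\<Union> C) C (length vs) C" unfolding is_cycle_def using vs W by blast
  have two: "{\<phi> \<in> {(R1, C), (R2, C)}. e \<in> snd \<phi>} = {(R1, C), (R2, C)}" if "e \<in> C" for e
    using that by auto
  have link: "{e\<in>C. v \<in> e} \<subseteq> {x, y}" if "x \<in> C" "y \<in> C" "x \<noteq> y" "v \<in> x" "v \<in> y" for x y v
  proof -
    have "v \<in> set vs" using that W by auto
    then obtain p q where "\<And>e. e \<in> C \<Longrightarrow> v \<in> e \<Longrightarrow> e = p \<or> e = q"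
      using cycle_at_vertex[of vs v] vs by metis
    then show ?thesis using that by blast
  qed
  show ?thesis
  proof
    show "finite C" using assms finite_cycle_edges by simp
    show "finite (\<Union> C)" using W by simp
    show "card {\<phi> \<in> {(R1, C), (R2, C)}. e \<in> snd \<phi>} = 2" if "e \<in> C" for e
      using two[OF that] \<open>R1 \<noteq> R2\<close> by simp
    show "card {(R1, C), (R2, C)} + card (\<Union> C) = card C + 2"
      using W card_cycle_edges[of vs] assms distinct_card[of vs] by simp
    show "\<exists>k. is_cycle (\<Union> C) C k (snd \<phi>)" if "\<phi> \<in> {(R1, C), (R2, C)}" for \<phi>
      using that cyc by auto
    show "e = x \<or> e = y" if "\<phi> \<in> {(R1, C), (R2, C)}" "x \<noteq> y" "v \<in> x" "v \<in> y" "x \<in> snd \<phi>" "y \<in> snd \<phi>"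
      "e \<in> C" "v \<in> e" for \<phi> x y v e
      using link[of x y v] that by auto
  qed auto
qed

text \<open>Combinatorial effect of an ear \<open>P\<close> that divides the face
  \<open>(R, C)\<close>; no geometry enters. Euler's formula survives because \<open>card P\<close>
  new edges come with \<open>card P - 1\<close> new vertices and one additional face. The delicate
  invariant is \<open>shared_corner\<close>.\<close>

lemma facial_ear:
  assumes fac: "facial W F \<Phi>" and RC: "(R, C) \<in> \<Phi>" and C: "C = C1 \<union> C2" "C1 \<inter> C2 = {}"
    and P: "P \<inter> F = {}" "finite P" "P \<noteq> {}" "\<Union> P \<inter> W = {a, b}" "finite (\<Union> P)"
      "card (\<Union> P - W) + 1 = card P"
    and ab: "a \<in> \<Union> C1" "b \<in> \<Union> C1" "a \<in> \<Union> C2" "b \<in> \<Union> C2"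
    and P1: "\<And>x y v. \<lbrakk>x \<in> P; y \<in> P; v \<in> x; v \<in> y; v = a \<or> v = b\<rbrakk> \<Longrightarrow> x = y"
    and P2: "\<And>x y z v. \<lbrakk>x \<in> P; y \<in> P; z \<in> P; v \<in> x; v \<in> y; v \<in> z\<rbrakk> \<Longrightarrow> x = y \<or> y = z \<or> x = z"
    and cyc: "is_cycle (W \<union> \<Union> P) (F \<union> P) k1 (C1 \<union> P)" "is_cycle (W \<union> \<Union> P) (F \<union> P) k2 (C2 \<union> P)"
  shows "facial (W \<union> \<Union> P) (F \<union> P) (insert (R1, C1 \<union> P) (insert (R2, C2 \<union> P) (\<Phi> - {(R, C)})))"
    (is "facial ?W ?F ?\<Phi>")
proof -
  interpret facial W F \<Phi> by (rule fac)
  note D = finite_faces finite_edges vertices finite_vertices face_cycle two_faces euler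
    shared_corner face_subset
  have CF: "C \<subseteq> F" using D(9)[OF RC] by simp
  have old: "snd \<phi> \<inter> P = {}" if "\<phi> \<in> \<Phi>" for \<phi> using D(9)[OF that] P(1) by blast
  have ne: "(R1, C1 \<union> P) \<noteq> (R2, C2 \<union> P)" using ab C CF P(1) by blast
  have notin: "(R1, C1 \<union> P) \<notin> \<Phi>" "(R2, C2 \<union> P) \<notin> \<Phi>"
    using old[of "(R1, C1 \<union> P)"] old[of "(R2, C2 \<union> P)"] P(3) by auto
  have two: "card {\<phi>\<in>?\<Phi>. e \<in> snd \<phi>} = 2" if "e \<in> ?F" for e
  proof (cases "e \<in> P")
    case True
    then have "{\<phi>\<in>?\<Phi>. e \<in> snd \<phi>} = {(R1, C1 \<union> P), (R2, C2 \<union> P)}" using old by auto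
    then show ?thesis using ne by simp
  next
    case False
    then have eF: "e \<in> F" using that by simp
    obtain \<phi> \<psi> where two: "\<phi> \<noteq> \<psi>" "{\<rho>\<in>\<Phi>. e \<in> snd \<rho>} = {\<phi>, \<psi>}" using facial_two[OF fac eF] .
    have eq: "{\<phi>\<in>?\<Phi>. e \<in> snd \<phi>} = (if e \<in> C1 then {(R1, C1 \<union> P)} else {}) \<union>
      (if e \<in> C2 then {(R2, C2 \<union> P)} else {}) \<union> {\<rho>\<in>\<Phi> - {(R, C)}. e \<in> snd \<rho>}"
      using False by auto
    \<comment> \<open>An edge of \<open>C\<close> trades the divided face for exactly one half,
      since \<open>C1\<close> and \<open>C2\<close> are disjoint. Every other old edge keeps its two
      faces.\<close>
    show ?thesis
    proof (cases "e \<in> C")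
      case True
      then have "(R, C) \<in> {\<rho>\<in>\<Phi>. e \<in> snd \<rho>}" using RC by simp
      then have "(R, C) = \<phi> \<or> (R, C) = \<psi>" unfolding two(2) by blast
      then obtain \<psi>' where \<psi>': "{\<rho>\<in>\<Phi>. e \<in> snd \<rho>} = {(R, C), \<psi>'}" "\<psi>' \<noteq> (R, C)"
        using two that[of \<phi>] that[of \<psi>] by (metis doubleton_eq_iff)
      then have in': "\<psi>' \<in> \<Phi>" by blast
      have rest: "{\<rho>\<in>\<Phi> - {(R, C)}. e \<in> snd \<rho>} = {\<psi>'}" using \<psi>' by blast
      have "e \<in> C1 \<and> e \<notin> C2 \<or> e \<in> C2 \<and> e \<notin> C1" using True C by blast
      then have "{\<phi>\<in>?\<Phi>. e \<in> snd \<phi>} = {(R1, C1 \<union> P), \<psi>'} \<or> {\<phi>\<in>?\<Phi>. e \<in> snd \<phi>} = {(R2, C2 \<union> P), \<psi>'}"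
        unfolding eq rest by auto
      moreover have "(R1, C1 \<union> P) \<noteq> \<psi>'" "(R2, C2 \<union> P) \<noteq> \<psi>'" using in' notin by auto
      ultimately show ?thesis by (elim disjE) (simp_all only: card_2_iff, blast+)
    next
      case eC: False
      then have "e \<notin> C1" "e \<notin> C2" using C by auto
      then have "{\<phi>\<in>?\<Phi>. e \<in> snd \<phi>} = {\<rho>\<in>\<Phi> - {(R, C)}. e \<in> snd \<rho>}" unfolding eq by simp
      also have "\<dots> = {\<rho>\<in>\<Phi>. e \<in> snd \<rho>}" using eC by auto
      finally have "{\<phi>\<in>?\<Phi>. e \<in> snd \<phi>} = {\<rho>\<in>\<Phi>. e \<in> snd \<rho>}" .
      then show ?thesis using two by simp
    qed
  qed
  have cards: "card ?\<Phi> + card ?W = card ?F + 2"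
  proof -
    have "card ?\<Phi> = card \<Phi> + 1"
      using D(1) RC ne notin by (simp add: card_Diff_singleton_if card_insert_if) 
        (metis Suc_pred card_gt_0_iff empty_iff)
    moreover have "card ?W = card W + card (\<Union> P - W)"
      using card_Un_disjoint[of W "\<Union> P - W"] D(4) P(5) by (simp add: Un_Diff_cancel)
    moreover have "card ?F = card F + card P"
      using card_Un_disjoint[of F P] D(2) P(1,2) by (simp add: Int_commute)
    ultimately show ?thesis using P(6) D(7) by linarith
  qed
  have atC: "v = a \<or> v = b \<Longrightarrow> \<exists>y1\<in>C1. \<exists>y2\<in>C2. v \<in> y1 \<and> v \<in> y2" for v using ab by blast
  \<comment> \<open>A corner formed by two ear edges sits at an inner vertex of the ear, where there
    are no other edges. Every other shared corner is traced back to the faces that existed before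
    the ear.\<close>
  have link: "e = x \<or> e = y"
    if \<phi>\<psi>: "\<phi> \<in> ?\<Phi>" "\<psi> \<in> ?\<Phi>" "\<phi> \<noteq> \<psi>" and xy: "x \<noteq> y" "v \<in> x" "v \<in> y" "x \<in> snd \<phi>" "y \<in> snd \<phi>" "x \<in> snd \<psi>" "y \<in> snd \<psi>"
      and e: "e \<in> ?F" "v \<in> e" for \<phi> \<psi> x y v e
  proof -
    have dis: "C1 \<inter> P = {}" "C2 \<inter> P = {}" using C CF P(1) by auto
    show ?thesis
    proof (cases "{x, y} \<subseteq> P")
      case True
      then have "v \<noteq> a" "v \<noteq> b" using P1[of x y v] xy by auto
      then have "v \<notin> W" using True xy P(4) by blast
      then have "e \<in> P" using e D(3) by blast
      then show ?thesis using P2[of x y e v] True xy e by auto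
    next
      case False
      have noP: "x \<notin> P \<and> y \<notin> P"
      proof (rule ccontr)
        assume *: "\<not> (x \<notin> P \<and> y \<notin> P)"
        have "\<phi> \<notin> \<Phi>" "\<psi> \<notin> \<Phi>" using * old xy by blast+
        then have "{\<phi>, \<psi>} = {(R1, C1 \<union> P), (R2, C2 \<union> P)}" using \<phi>\<psi> by auto
        then have "x \<in> C1 \<union> P" "x \<in> C2 \<union> P" "y \<in> C1 \<union> P" "y \<in> C2 \<union> P" 
          using xy by (auto simp: doubleton_eq_iff)
        then show False using False C dis by auto
      qed
      \<comment> \<open>Both halves are sent back to the face they came from. Distinct faces with
        the same image would be the two halves, and these have only ear edges in common.\<close>
      define old_face where "old_face = (\<lambda>\<phi>. if \<phi> = (R1, C1 \<union> P) \<or> \<phi> = (R2, C2 \<union> P) then (R, C) else \<phi>)"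
      have old_face: "old_face \<rho> \<in> \<Phi> \<and> snd \<rho> - P \<subseteq> snd (old_face \<rho>)" if "\<rho> \<in> ?\<Phi>" for \<rho>
      proof (cases "\<rho> = (R1, C1 \<union> P) \<or> \<rho> = (R2, C2 \<union> P)")
        case True
        then have "old_face \<rho> = (R, C)" "snd \<rho> \<subseteq> C \<union> P" using C(1) by (auto simp: old_face_def)
        then show ?thesis using RC by auto
      next
        case False
        then have "old_face \<rho> = \<rho>" "\<rho> \<in> \<Phi>" using that by (auto simp: old_face_def)
        then show ?thesis by auto
      qed
      have of: "old_face \<phi> \<in> \<Phi>" "old_face \<psi> \<in> \<Phi>" "x \<in> snd (old_face \<phi>)" "y \<in> snd (old_face \<phi>)"
        "x \<in> snd (old_face \<psi>)" "y \<in> snd (old_face \<psi>)"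
        using old_face[OF \<phi>\<psi>(1)] old_face[OF \<phi>\<psi>(2)] xy noP by blast+
      have "old_face \<phi> \<noteq> old_face \<psi>"
      proof
        assume eq: "old_face \<phi> = old_face \<psi>"
        have iff: "old_face \<rho> = (R, C) \<longleftrightarrow> \<rho> \<in> {(R1, C1 \<union> P), (R2, C2 \<union> P)}" if "\<rho> \<in> ?\<Phi>" for \<rho>
          using that by (auto simp: old_face_def)
        have "\<phi> \<in> {(R1, C1 \<union> P), (R2, C2 \<union> P)} \<and> \<psi> \<in> {(R1, C1 \<union> P), (R2, C2 \<union> P)}"
        proof (rule ccontr)
          assume "\<not> ?thesis"
          then have "\<phi> \<notin> {(R1, C1 \<union> P), (R2, C2 \<union> P)}" "\<psi> \<notin> {(R1, C1 \<union> P), (R2, C2 \<union> P)}"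
            using iff[OF \<phi>\<psi>(1)] iff[OF \<phi>\<psi>(2)] eq by metis+
          then show False using eq \<open>\<phi> \<noteq> \<psi>\<close> unfolding old_face_def by simp
        qed
        then have "snd \<phi> = C1 \<union> P \<and> snd \<psi> = C2 \<union> P \<or> snd \<phi> = C2 \<union> P \<and> snd \<psi> = C1 \<union> P"
          using \<open>\<phi> \<noteq> \<psi>\<close> by auto
        then show False using xy noP C(2) by blast
      qed
      then have deg: "e' = x \<or> e' = y" if "e' \<in> F" "v \<in> e'" for e'
        using D(8)[of "old_face \<phi>" "old_face \<psi>" x y v e'] of xy that by blast
      \<comment> \<open>An ear edge at \<open>v\<close> would make \<open>v\<close> an end of the
        ear. By \<open>deg\<close>, one of \<open>x\<close>, \<open>y\<close> then lies in
        \<open>C1\<close> and the other in \<open>C2\<close>, so neither \<phi> nor \<psi> is a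
        half, and \<open>x\<close> would lie on the three old faces \<open>(R, C)\<close>, \<phi>
        and \<psi>.\<close>
      have "e \<notin> P"
      proof
        assume "e \<in> P"
        have "v \<in> W" using of(1,3) D(3,9) xy by blast
        then have "v = a \<or> v = b" using \<open>e \<in> P\<close> e P(4) by blast
        then obtain y1 y2 where y12: "y1 \<in> C1" "y2 \<in> C2" "v \<in> y1" "v \<in> y2"
          using atC[of v] by (elim disjE) auto
        have "y1 \<in> F" "y2 \<in> F" "y1 \<noteq> y2" using y12 C CF by blast+
        then have "x = y1 \<and> y = y2 \<or> x = y2 \<and> y = y1"
          using deg[of y1] deg[of y2] y12 by metis
        then have xC: "x \<in> C1 \<and> y \<in> C2 \<or> x \<in> C2 \<and> y \<in> C1" using y12 by blast
        have "\<rho> \<noteq> (R1, C1 \<union> P)" "\<rho> \<noteq> (R2, C2 \<union> P)" if "x \<in> snd \<rho>" "y \<in> snd \<rho>" for \<rho>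
          using that xC noP C(2) by force+
        then have "\<phi> \<in> \<Phi>" "\<psi> \<in> \<Phi>" "\<phi> \<noteq> (R, C)" "\<psi> \<noteq> (R, C)" using \<phi>\<psi> xy by blast+
        moreover have "x \<in> C" using xC C by blast
        ultimately show False
          using facial_not_three[OF fac, of x "(R, C)" \<phi> \<psi>] RC CF xy \<open>\<phi> \<noteq> \<psi>\<close> by auto
      qed
      then show ?thesis using deg e by auto
    qed
  qed
  show ?thesis
  proof
    show "\<exists>k. is_cycle ?W ?F k (snd \<phi>)" if "\<phi> \<in> ?\<Phi>" for \<phi>
      using that D(5)[of \<phi>] cyc is_cycle_mono[of W F _ _ ?W ?F] by fastforce
    show "finite ?\<Phi>" "?\<Phi> \<noteq> {}" "finite ?F" "finite ?W" using D(1,2,4) P by auto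
    show "?W = \<Union> ?F" using D(3) by simp
  qed (fact two cards link)+
qed

section \<open>Plane embeddings\<close>

text \<open>A common edge would have to be \<open>{a, b}\<close>, and then both paths would be that
  single edge. The lemma is applied to each pair among the two halves of a face boundary and an
  ear.\<close>

lemma path_pair:
  assumes "distinct (a # xs @ [b])" "distinct (a # ys @ [b])" "set xs \<inter> set ys = {}" "xs \<noteq> [] \<or> ys \<noteq> []"
  shows "path_edges (a # xs @ [b]) \<inter> path_edges (a # ys @ [b]) = {}"
    and "\<Union> (path_edges (a # xs @ [b])) \<inter> \<Union> (path_edges (a # ys @ [b])) = {a, b}"
    and "\<lbrakk>set (a # xs @ [b]) \<union> set ys \<subseteq> W; path_edges (a # xs @ [b]) \<union> path_edges (a # ys @ [b]) \<subseteq> F\<rbrakk> \<Longrightarrow>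
      is_cycle W F (length xs + length ys + 2) (path_edges (a # xs @ [b]) \<union> path_edges (a # ys @ [b]))"
proof -
  show "path_edges (a # xs @ [b]) \<inter> path_edges (a # ys @ [b]) = {}"
  proof (rule ccontr)
    assume "\<not> ?thesis"
    then obtain e where e: "e \<in> path_edges (a # xs @ [b])" "e \<in> path_edges (a # ys @ [b])" by blast
    have "e \<subseteq> {a, b}" using path_edges_subset[OF e(1)] path_edges_subset[OF e(2)] assms(3) by auto
    moreover have "card e = 2" using path_edges_card2[OF assms(1) e(1)] .
    ultimately have eab: "e = {a, b}" using card_subset_eq[of "{a, b}" e] assms(1) by simp
    have "xs = []"
      using path_edges_hd[OF assms(1) e(1)] eab assms(1) by (cases xs) (auto simp: doubleton_eq_iff)
    moreover have "ys = []"
      using path_edges_hd[OF assms(2) e(2)] eab assms(2) by (cases ys) (auto simp: doubleton_eq_iff)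
    ultimately show False using assms(4) by simp
  qed
  show "\<Union> (path_edges (a # xs @ [b])) \<inter> \<Union> (path_edges (a # ys @ [b])) = {a, b}"
    using Union_path_edges[of "a # xs @ [b]"] Union_path_edges[of "a # ys @ [b]"] assms(3) assms(1,2) by auto
  assume W: "set (a # xs @ [b]) \<union> set ys \<subseteq> W" and F: "path_edges (a # xs @ [b]) \<union> path_edges (a # ys @ [b]) \<subseteq> F"
  let ?vs = "a # xs @ b # rev ys"
  have "length ?vs = length xs + length ys + 2" "length xs + length ys + 2 \<ge> 3" "distinct ?vs" "set ?vs \<subseteq> W"
    using assms W by (auto simp: Suc_le_eq)
  then show "is_cycle W F (length xs + length ys + 2) (path_edges (a # xs @ [b]) \<union> path_edges (a # ys @ [b]))"
    unfolding is_cycle_def using F cycle_edges_two_rev[of a xs b ys] by metis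
qed

locale plane_graph =
  fixes V :: "'a set" and E :: "'a set set" and pos :: "'a \<Rightarrow> complex" and \<gamma> :: "'a set \<Rightarrow> real \<Rightarrow> complex"
  assumes finite_V: "finite V"
    and edge: "e \<in> E \<Longrightarrow> e \<subseteq> V" "e \<in> E \<Longrightarrow> card e = 2"
    and inj_pos: "inj_on pos V"
    and arc_edge: "e \<in> E \<Longrightarrow> arc (\<gamma> e)"
    and ends_edge: "e \<in> E \<Longrightarrow> {pathstart (\<gamma> e), pathfinish (\<gamma> e)} = pos ` e"
    and edge_meets_V: "e \<in> E \<Longrightarrow> path_image (\<gamma> e) \<inter> pos ` V = pos ` e"
    and edges_meet: "e \<in> E \<Longrightarrow> f \<in> E \<Longrightarrow> e \<noteq> f \<Longrightarrow> path_image (\<gamma> e) \<inter> path_image (\<gamma> f) = pos ` (e \<inter> f)"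
begin

definition U :: "'a set set \<Rightarrow> complex set" where "U A = (\<Union>e\<in>A. path_image (\<gamma> e))"

lemma U_Un: "U (A \<union> B) = U A \<union> U B" by (auto simp: U_def)

lemma U_vertex: "A \<subseteq> E \<Longrightarrow> v \<in> \<Union> A \<Longrightarrow> pos v \<in> U A"
proof -
  assume "A \<subseteq> E" "v \<in> \<Union> A"
  then obtain e where e: "e \<in> A" "e \<in> E" "pos v \<in> pos ` e" by blast
  then have "pos v \<in> {pathstart (\<gamma> e), pathfinish (\<gamma> e)}" using ends_edge by simp
  then show "pos v \<in> U A" 
    using e(1) pathstart_in_path_image[of "\<gamma> e"] pathfinish_in_path_image[of "\<gamma> e"]
    unfolding U_def by auto
qed

lemma U_meets_V:
  assumes "A \<subseteq> E" "v \<in> V" "pos v \<in> U A"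
  shows "v \<in> \<Union> A"
proof -
  obtain e where e: "e \<in> A" "pos v \<in> path_image (\<gamma> e)" using assms(3) by (auto simp: U_def)
  then have "pos v \<in> pos ` e" using edge_meets_V[of e] assms by blast
  then have "v \<in> e" using inj_pos edge(1)[of e] assms e by (metis inj_on_image_mem_iff subsetD)
  then show ?thesis using e by blast
qed

text \<open>This turns disjointness of edge sets into the condition that the drawn arcs meet only in
  common vertices, as a theta curve requires.\<close>

lemma U_Int:
  assumes "A \<subseteq> E" "B \<subseteq> E" "A \<inter> B = {}"
  shows "U A \<inter> U B = pos ` (\<Union> A \<inter> \<Union> B)"
proof
  show "U A \<inter> U B \<subseteq> pos ` (\<Union> A \<inter> \<Union> B)"
  proof
    fix x assume "x \<in> U A \<inter> U B"
    then obtain e f where "e \<in> A" "f \<in> B" "x \<in> path_image (\<gamma> e) \<inter> path_image (\<gamma> f)" by (auto simp: U_def)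
    moreover from this have "x \<in> pos ` (e \<inter> f)" using edges_meet[of e f] assms by blast
    ultimately show "x \<in> pos ` (\<Union> A \<inter> \<Union> B)" by blast
  qed
  show "pos ` (\<Union> A \<inter> \<Union> B) \<subseteq> U A \<inter> U B" using U_vertex assms by blast
qed

text \<open>The drawing fixes the ends of an edge only as an unordered pair, so the arc is reversed
  when necessary.\<close>

lemma edge_arc:
  assumes "{x, y} \<in> E" "x \<noteq> y"
  obtains g where "arc g" "pathstart g = pos x" "pathfinish g = pos y" "path_image g = path_image (\<gamma> {x, y})"
proof -
  have "{pathstart (\<gamma> {x, y}), pathfinish (\<gamma> {x, y})} = {pos x, pos y}" using ends_edge[OF assms(1)] by simp
  then consider "pathstart (\<gamma> {x, y}) = pos x" "pathfinish (\<gamma> {x, y}) = pos y"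
    | "pathstart (\<gamma> {x, y}) = pos y" "pathfinish (\<gamma> {x, y}) = pos x"
    by (auto simp: doubleton_eq_iff)
  then show thesis
  proof cases
    case 1 then show thesis using that[of "\<gamma> {x, y}"] arc_edge[OF assms(1)] by simp
  next
    case 2 then show thesis using that[of "reversepath (\<gamma> {x, y})"] arc_edge[OF assms(1)]
      by (simp add: arc_reversepath)
  qed
qed

lemma path_arc:
  assumes "distinct ws" "length ws \<ge> 2" "path_edges ws \<subseteq> E"
  shows "\<exists>g. arc g \<and> pathstart g = pos (hd ws) \<and> pathfinish g = pos (last ws) \<and> path_image g = U (path_edges ws)"
  using assms
proof (induction ws rule: path_edges.induct)
  case (1 x y zs)
  obtain g1 where g1: "arc g1" "pathstart g1 = pos x" "pathfinish g1 = pos y" "path_image g1 = path_image (\<gamma> {x, y})"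
    using edge_arc[of x y] 1 by auto
  show ?case
  proof (cases zs)
    case Nil then show ?thesis using g1 by (intro exI[of _ g1]) (auto simp: U_def)
  next
    case (Cons z zs')
    then obtain g2 where g2: "arc g2" "pathstart g2 = pos y" "pathfinish g2 = pos (last zs)"
      "path_image g2 = U (path_edges (y # zs))"
      using 1 by auto
    have ni: "{x, y} \<notin> path_edges (y # zs)" using path_edges_subset[of "{x, y}" "y # zs"] 1(2) by auto
    have "path_image g1 \<inter> path_image g2 = U {{x, y}} \<inter> U (path_edges (y # zs))"
      using g1 g2 by (simp add: U_def)
    also have "\<dots> = pos ` (\<Union> {{x, y}} \<inter> \<Union> (path_edges (y # zs)))"
      using 1(4) ni by (intro U_Int) auto
    also have "\<dots> \<subseteq> {pos y}" using path_edges_subset[of _ "y # zs"] 1(2) by auto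
    finally have "path_image g1 \<inter> path_image g2 \<subseteq> {pathstart g2}" using g2 by simp
    then have "arc (g1 +++ g2)" using g1 g2 by (intro arc_join) auto
    moreover have "path_image (g1 +++ g2) = U (path_edges (x # y # zs))"
      using g1 g2 by (simp add: path_image_join U_def)
    ultimately show ?thesis using g1 g2 Cons by (intro exI[of _ "g1 +++ g2"]) auto
  qed
qed auto

lemma path_arc_between:
  assumes "distinct (a # p @ [b])" "path_edges (a # p @ [b]) \<subseteq> E"
  obtains g where "arc g" "pathstart g = pos a" "pathfinish g = pos b" "path_image g = U (path_edges (a # p @ [b]))"
  using path_arc[OF assms(1) _ assms(2)] by auto

lemma cycle_loop:
  assumes "distinct vs" "length vs \<ge> 3" "cycle_edges vs \<subseteq> E"
  obtains c where "simple_path c" "pathfinish c = pathstart c" "path_image c = U (cycle_edges vs)"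
proof -
  obtain a zs where 1: "vs = a # zs" "length zs \<ge> 2" using assms(2) by (cases vs) auto
  then obtain xs b where 2: "zs = xs @ [b]" by (metis append_butlast_last_id list.size(3) not_numeral_le_zero)
  have ne: "xs \<noteq> []" using 1 2 by auto
  have d: "distinct (a # xs @ [b])" "distinct (a # [] @ [b])" using assms(1) 1 2 by auto
  \<comment> \<open>The closing edge of the cycle is viewed as a second path from \<open>a\<close>
    to \<open>b\<close>, with empty interior.\<close>
  have C: "cycle_edges vs = path_edges (a # xs @ [b]) \<union> path_edges (a # [] @ [b])"
    using cycle_edges_two_rev[of a xs b "[]"] 1 2 by simp
  obtain g1 where g1: "arc g1" "pathstart g1 = pos a" "pathfinish g1 = pos b" "path_image g1 = U (path_edges (a # xs @ [b]))"
    using path_arc_between[OF d(1)] C assms(3) by blast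
  obtain g2 where g2: "arc g2" "pathstart g2 = pos a" "pathfinish g2 = pos b" "path_image g2 = U (path_edges (a # [] @ [b]))"
    using path_arc_between[OF d(2)] C assms(3) by blast
  have "path_image g1 \<inter> path_image g2 = {pos a, pos b}"
    using U_Int[of "path_edges (a # xs @ [b])" "path_edges (a # [] @ [b])"] path_pair[OF d] ne C assms(3) g1 g2
    by (simp del: path_edges.simps append.simps)
  note loop = arcs_loop[OF g1(1) g2(1) g1(2,3) g2(2,3) this]
  show thesis
    by (rule that[OF loop(1,2)]) (simp only: loop(3) g1(4) g2(4) C U_Un)
qed

section \<open>Jordan regions as faces, and the addition of an ear\<close>

text \<open>The invariant of the ear construction, in which the labels of the faces are their
  regions. That the regions fill the complement of the drawing is what yields a face for each new
  ear.\<close>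

definition plane_faces :: "'a set \<Rightarrow> 'a set set \<Rightarrow> (complex set \<times> 'a set set) set \<Rightarrow> bool" where
  "plane_faces W F \<Phi> \<longleftrightarrow> facial W F \<Phi> \<and> F \<subseteq> E \<and> (\<forall>\<phi>\<in>\<Phi>. jordan_region (fst \<phi>) (U (snd \<phi>))) \<and>
    (\<forall>\<phi>\<in>\<Phi>. \<forall>\<psi>\<in>\<Phi>. \<phi> \<noteq> \<psi> \<longrightarrow> fst \<phi> \<inter> fst \<psi> = {}) \<and> \<Union> (fst ` \<Phi>) = - U F"

lemma plane_faces_cycle:
  assumes "distinct vs" "length vs \<ge> 3" "cycle_edges vs \<subseteq> E"
  shows "\<exists>\<Phi>. plane_faces (set vs) (cycle_edges vs) \<Phi>"
proof -
  let ?C = "cycle_edges vs" let ?J = "U (cycle_edges vs)"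
  obtain c where c: "simple_path c" "pathfinish c = pathstart c" "path_image c = ?J"
    using cycle_loop[OF assms] .
  have ne: "inside ?J \<noteq> outside ?J"
    using Jordan_inside_outside[OF c(1,2)] c(3) by auto
  have "facial (\<Union> ?C) ?C {(inside ?J, ?C), (outside ?J, ?C)}"
    using facial_cycle[OF assms(1,2) refl ne] .
  moreover have "\<Union> ?C = set vs" using Union_cycle_edges[of vs] assms(2) by simp
  ultimately have "plane_faces (set vs) ?C {(inside ?J, ?C), (outside ?J, ?C)}"
    unfolding plane_faces_def using assms(3) 
    by (auto simp: jordan_region_def Int_commute inside_Un_outside)
  then show ?thesis by blast
qed

text \<open>Without its ends the ear is connected and avoids the drawing of \<open>F\<close>, so it
  lies in one region \<open>R\<close>. Its ends lie in the closure of \<open>R\<close> but on the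
  drawing, hence on the boundary cycle \<open>C\<close>, which they divide into two paths. These and
  the ear form a theta curve, and \<open>region_split\<close> supplies the labels of the new
  faces.\<close>

lemma plane_faces_ear:
  assumes pf: "plane_faces W F \<Phi>" and ab: "a \<in> W" "b \<in> W" and d: "distinct (a # p @ [b])"
    and pW: "set p \<inter> W = {}" and PE: "path_edges (a # p @ [b]) \<subseteq> E" and PF: "path_edges (a # p @ [b]) \<inter> F = {}"
  shows "\<exists>\<Phi>'. plane_faces (W \<union> set p) (F \<union> path_edges (a # p @ [b])) \<Phi>'"
proof -
  define P where "P = path_edges (a # p @ [b])"
  have fac: "facial W F \<Phi>" and FE: "F \<subseteq> E" and reg: "\<And>\<phi>. \<phi> \<in> \<Phi> \<Longrightarrow> jordan_region (fst \<phi>) (U (snd \<phi>))"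
    and disj: "\<And>\<phi> \<psi>. \<phi> \<in> \<Phi> \<Longrightarrow> \<psi> \<in> \<Phi> \<Longrightarrow> \<phi> \<noteq> \<psi> \<Longrightarrow> fst \<phi> \<inter> fst \<psi> = {}" and un: "\<Union> (fst ` \<Phi>) = - U F"
    using pf unfolding plane_faces_def by auto
  interpret facial W F \<Phi> by (rule fac)
  have WV: "W \<subseteq> V" using vertices FE edge by blast
  have UP: "\<Union> P = set (a # p @ [b])" using Union_path_edges[of "a # p @ [b]"] P_def by simp
  have UPW: "\<Union> P \<inter> W = {a, b}" using UP pW ab by auto
  obtain c where c: "arc c" "pathstart c = pos a" "pathfinish c = pos b" "path_image c = U P"
    using path_arc_between[OF d PE] P_def by blast
  define c' where "c' = U P - {pos a, pos b}"
  have c'ne: "c' \<noteq> {}" and c'con: "connected c'"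
    using nonempty_simple_path_endless connected_simple_path_endless c arc_imp_simple_path c'_def by metis+
  have "U P \<inter> U F = pos ` (\<Union> P \<inter> \<Union> F)" using U_Int[of P F] PE FE PF P_def by simp
  then have UPF: "U P \<inter> U F = {pos a, pos b}" using UPW vertices by simp
  have region: "\<exists>c. simple_path c \<and> pathfinish c = pathstart c \<and> path_image c = U (snd \<phi>)" if \<phi>: "\<phi> \<in> \<Phi>" for \<phi>
  proof -
    obtain k where "is_cycle W F k (snd \<phi>)" using face_cycle[OF \<phi>] by blast
    then obtain vs where "distinct vs" "length vs \<ge> 3" "snd \<phi> = cycle_edges vs" "cycle_edges vs \<subseteq> E"
      using FE by (elim is_cycleE) auto
    then show ?thesis using cycle_loop[of vs] by metis
  qed
  have op: "open (fst \<phi>)" "closure (fst \<phi>) \<subseteq> fst \<phi> \<union> U (snd \<phi>)" if "\<phi> \<in> \<Phi>" for \<phi>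
    using region[OF that] reg[OF that] jordan_region_topology by metis+
  have c'un: "c' \<subseteq> \<Union> (fst ` \<Phi>)" using un UPF c'_def by blast
  obtain R C where RC: "(R, C) \<in> \<Phi>" "c' \<inter> R \<noteq> {}" using c'ne c'un by fastforce
  have c'R: "c' \<subseteq> R"
  proof -
    let ?R' = "\<Union> (fst ` (\<Phi> - {(R, C)}))"
    have "open R" using op(1)[OF RC(1)] by simp
    moreover have "open ?R'" using op(1) by blast
    moreover have "R \<inter> ?R' = {}" using disj[OF RC(1)] by fastforce
    moreover have "c' \<subseteq> R \<union> ?R'"
    proof
      fix x assume "x \<in> c'"
      then obtain \<phi> where "\<phi> \<in> \<Phi>" "x \<in> fst \<phi>" using c'un by blast
      then show "x \<in> R \<union> ?R'" by (cases "\<phi> = (R, C)") auto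
    qed
    ultimately show ?thesis using connectedD[OF c'con, of R ?R'] RC(2) by blast
  qed
  have RU: "R \<inter> U F = {}" using un RC(1) by force
  have CF: "C \<subseteq> F" using face_subset[OF RC(1)] by simp
  have inC: "v \<in> \<Union> C" if "v = a \<or> v = b" for v
  proof -
    have "pos v \<in> closure c'"
      using arc_ends_in_closure[OF c(1)] that c c'_def by auto
    then have "pos v \<in> closure R" using closure_mono[OF c'R] by blast
    moreover have "pos v \<in> U F" using UPF that by blast
    ultimately have "pos v \<in> U C" using op(2)[OF RC(1)] RU by auto
    then show ?thesis using U_meets_V[of C v] CF FE WV ab that by blast
  qed
  obtain k where "is_cycle W F k C" using face_cycle[OF RC(1)] by auto
  then obtain vs where vs: "distinct vs" "length vs \<ge> 3" "C = cycle_edges vs" "\<Union> C = set vs" "set vs \<subseteq> W"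
    by (rule is_cycleE) auto
  have "a \<in> set vs" "b \<in> set vs" "a \<noteq> b" using inC[of a] inC[of b] vs d by auto
  then obtain xs zs where xz: "distinct (a # xs @ b # zs)" "C = cycle_edges (a # xs @ b # zs)"
    "set vs = set (a # xs @ b # zs)" "length vs = length (a # xs @ b # zs)"
    using cycle_split_at[OF vs(1)] vs(3) by metis
  define ys where "ys = rev zs"
  have zs: "zs = rev ys" by (simp add: ys_def)
  define C1 where "C1 = path_edges (a # xs @ [b])"
  define C2 where "C2 = path_edges (a # ys @ [b])"
  have C: "C = C1 \<union> C2" using xz(2) zs cycle_edges_two_rev[of a xs b ys] C1_def C2_def by simp
  have dx: "distinct (a # xs @ [b])" and dy: "distinct (a # ys @ [b])" and sxy: "set xs \<inter> set ys = {}"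
    using xz(1) zs by auto
  have xyW: "set xs \<subseteq> W" "set ys \<subseteq> W" using xz(3) vs(5) zs by auto
  have sxp: "set xs \<inter> set p = {}" and syp: "set ys \<inter> set p = {}" using xyW pW by auto
  have nexy: "xs \<noteq> [] \<or> ys \<noteq> []" using xz(4) vs(2) zs by auto
  \<comment> \<open>If this half and the ear were both the single edge \<open>{a, b}\<close>, that
    edge would already belong to \<open>F\<close>.\<close>
  have nexp: "xs \<noteq> [] \<or> p \<noteq> []"
    using C C1_def CF PF by auto
  have neyp: "ys \<noteq> [] \<or> p \<noteq> []"
    using C C2_def CF PF by auto
  note pxy = path_pair[OF dx dy sxy nexy, folded C1_def C2_def]
  note pxp = path_pair[OF dx d sxp nexp, folded C1_def P_def]
  note pyp = path_pair[OF dy d syp neyp, folded C2_def P_def]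
  have E12: "C1 \<subseteq> E" "C2 \<subseteq> E" "P \<subseteq> E" using C CF FE PE P_def by auto
  obtain c1 where c1: "arc c1" "pathstart c1 = pos a" "pathfinish c1 = pos b" "path_image c1 = U C1"
    using path_arc_between[OF dx] E12(1) C1_def by metis
  obtain c2 where c2: "arc c2" "pathstart c2 = pos a" "pathfinish c2 = pos b" "path_image c2 = U C2"
    using path_arc_between[OF dy] E12(2) C2_def by metis
  interpret theta_arcs c1 c2 c "pos a" "pos b"
    using c c1 c2 U_Int[OF E12(1,2) pxy(1)] U_Int[OF E12(1,3) pxp(1)] U_Int[OF E12(2,3) pyp(1)]
      pxy(2) pxp(2) pyp(2)
    by unfold_locales auto
  have "jordan_region R (path_image c1 \<union> path_image c2)"
    using reg[OF RC(1)] c1 c2 C U_Un by simp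
  then obtain R1 R2 where R12: "jordan_region R1 (U (C1 \<union> P))" "jordan_region R2 (U (C2 \<union> P))"
    "R1 \<inter> R2 = {}" "R1 \<union> R2 \<union> c' = R"
    using region_split[of R] c'R c(4) c1(4) c2(4) U_Un c'_def by metis
  let ?\<Phi> = "insert (R1, C1 \<union> P) (insert (R2, C2 \<union> P) (\<Phi> - {(R, C)}))"
  have f1: "facial (W \<union> \<Union> P) (F \<union> P) ?\<Phi>"
  proof (rule facial_ear[OF fac RC(1) C pxy(1)])
    show "P \<inter> F = {}" using PF P_def by simp
    show "finite P" by (simp add: P_def finite_path_edges)
    show "P \<noteq> {}" using UP by auto
    show "\<Union> P \<inter> W = {a, b}" by (rule UPW)
    show "finite (\<Union> P)" using UP by simp
    have "\<Union> P - W = set p" using UP pW ab by auto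
    then show "card (\<Union> P - W) + 1 = card P"
      using card_path_edges[OF d] d distinct_card[of p] P_def by simp
    show "a \<in> \<Union> C1" "b \<in> \<Union> C1" "a \<in> \<Union> C2" "b \<in> \<Union> C2" using pxy(2) by auto
    show "x = y" if "x \<in> P" "y \<in> P" "v \<in> x" "v \<in> y" "v = a \<or> v = b" for x y v
      using path_edges_end_unique[OF d] that P_def by metis
    show "x = y \<or> y = z \<or> x = z" if "x \<in> P" "y \<in> P" "z \<in> P" "v \<in> x" "v \<in> y" "v \<in> z" for x y z v
      using path_edges_at_most_two[OF d] that P_def by metis
    show "is_cycle (W \<union> \<Union> P) (F \<union> P) (length xs + length p + 2) (C1 \<union> P)"
      using xyW UP C CF ab by (intro pxp(3)) auto
    show "is_cycle (W \<union> \<Union> P) (F \<union> P) (length ys + length p + 2) (C2 \<union> P)"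
      using xyW UP C CF ab by (intro pyp(3)) auto
  qed
  have f2: "W \<union> \<Union> P = W \<union> set p" using UP ab by auto
  have f3: "jordan_region (fst \<phi>) (U (snd \<phi>))" if "\<phi> \<in> ?\<Phi>" for \<phi>
    using that reg R12 by auto
  have f4: "fst \<phi> \<inter> fst \<psi> = {}" if pp: "\<phi> \<in> ?\<Phi>" "\<psi> \<in> ?\<Phi>" "\<phi> \<noteq> \<psi>" for \<phi> \<psi>
  proof -
    have sub: "R1 \<subseteq> R" "R2 \<subseteq> R" using R12 by auto
    have o: "fst \<rho> \<inter> R = {}" if "\<rho> \<in> \<Phi> - {(R, C)}" for \<rho> using disj[OF _ RC(1), of \<rho>] that by auto
    consider "\<phi> \<in> \<Phi> - {(R, C)}" "\<psi> \<in> \<Phi> - {(R, C)}" | "\<phi> \<in> \<Phi> - {(R, C)}" "fst \<psi> \<subseteq> R"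
      | "\<psi> \<in> \<Phi> - {(R, C)}" "fst \<phi> \<subseteq> R" | "fst \<phi> = R1 \<and> fst \<psi> = R2 \<or> fst \<phi> = R2 \<and> fst \<psi> = R1"
      using pp sub by auto
    then show ?thesis
    proof cases
      case 1 then show ?thesis using disj pp(3) by simp
    next
      case 2 then show ?thesis using o[of \<phi>] by blast
    next
      case 3 then show ?thesis using o[of \<psi>] by blast
    next
      case 4 then show ?thesis using R12(3) by blast
    qed
  qed
  have f5: "\<Union> (fst ` ?\<Phi>) = - U (F \<union> P)"
  proof -
    have "\<Union> (fst ` ?\<Phi>) = R1 \<union> R2 \<union> \<Union> (fst ` (\<Phi> - {(R, C)}))" by auto
    also have "R1 \<union> R2 = R - c'"
    proof -
      have "R1 \<inter> U (C1 \<union> P) = {}" "R2 \<inter> U (C2 \<union> P) = {}"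
        using R12(1,2) inside_no_overlap outside_no_overlap unfolding jordan_region_def by metis+
      then have "(R1 \<union> R2) \<inter> c' = {}" unfolding U_Un c'_def by blast
      then show ?thesis using R12(4) by blast
    qed
    also have "R - c' \<union> \<Union> (fst ` (\<Phi> - {(R, C)})) = \<Union> (fst ` \<Phi>) - c'"
    proof -
      have "\<Union> (fst ` \<Phi>) = R \<union> \<Union> (fst ` (\<Phi> - {(R, C)}))" using RC(1) by force
      moreover have "R \<inter> \<Union> (fst ` (\<Phi> - {(R, C)})) = {}" using disj[OF RC(1)] by fastforce
      ultimately show ?thesis using c'R by blast
    qed
    also have "\<dots> = - U (F \<union> P)" using un UPF c'_def U_Un by auto
    finally show ?thesis .
  qed
  have "F \<union> P \<subseteq> E" using FE PE P_def by simp
  then have "plane_faces (W \<union> set p) (F \<union> P) ?\<Phi>"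
    unfolding plane_faces_def by (intro conjI ballI impI f1[unfolded f2] f3 f4 f5)
  then show ?thesis unfolding P_def[symmetric] by (rule exI)
qed

end

section \<open>Discharging and the edge bound\<close>

lemma planar_graph_iff:
  fixes V :: "'a set"
  assumes "finite_simple_graph V E"
  shows "planar_graph V E \<longleftrightarrow> (\<exists>pos \<gamma>. plane_graph V E pos \<gamma>)"
proof
  assume "planar_graph V E"
  then show "\<exists>pos \<gamma>. plane_graph V E pos \<gamma>"
    unfolding planar_graph_def
  proof (elim ex_forward)
    fix pos and \<gamma> :: "'a set \<Rightarrow> real \<Rightarrow> complex"
    assume "inj_on pos V \<and>
       (\<forall>e\<in>E. arc (\<gamma> e) \<and> {pathstart (\<gamma> e), pathfinish (\<gamma> e)} = pos ` e \<and>
               path_image (\<gamma> e) \<inter> pos ` V = pos ` e) \<and>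
       (\<forall>e\<in>E. \<forall>f\<in>E. e \<noteq> f \<longrightarrow>
               path_image (\<gamma> e) \<inter> path_image (\<gamma> f) = pos ` (e \<inter> f))"
    then show "plane_graph V E pos \<gamma>"
      using assms unfolding finite_simple_graph_def by unfold_locales simp_all
  qed
next
  assume "\<exists>pos \<gamma>. plane_graph V E pos \<gamma>"
  then obtain pos \<gamma> where "plane_graph V E pos \<gamma>" by blast
  then interpret plane_graph V E pos \<gamma> .
  show "planar_graph V E" unfolding planar_graph_def
    by (intro exI[of _ pos] exI[of _ \<gamma>])
      (simp add: inj_pos arc_edge ends_edge edge_meets_V edges_meet)
qed

lemma (in plane_graph) plane_subgraph:
  assumes "V' \<subseteq> V" "E' \<subseteq> E" "\<And>e. e \<in> E' \<Longrightarrow> e \<subseteq> V'"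
  shows "plane_graph V' E' pos \<gamma>"
proof
  show "path_image (\<gamma> e) \<inter> pos ` V' = pos ` e" if "e \<in> E'" for e
    using edge_meets_V[of e] that assms by blast
  show "finite V'" using finite_V assms(1) finite_subset by blast
  show "inj_on pos V'" using inj_pos assms(1) inj_on_subset by blast
  show "card e = 2" "arc (\<gamma> e)" "{pathstart (\<gamma> e), pathfinish (\<gamma> e)} = pos ` e" if "e \<in> E'" for e
    using that assms(2) edge(2)[of e] arc_edge[of e] ends_edge[of e] by blast+
  show "path_image (\<gamma> e) \<inter> path_image (\<gamma> f) = pos ` (e \<inter> f)" if "e \<in> E'" "f \<in> E'" "e \<noteq> f" for e f
    using that assms(2) edges_meet[of e f] by blast
qed (fact assms(3))

text \<open>Taking \<open>F\<close> of greatest size turns the ear step into the statement that no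
  ear exists; an ear with \<open>p = []\<close> is a missing edge between two vertices of
  \<open>W\<close>. The regions survive only as labels, without any geometric property.\<close>

lemma planar_facial:
  fixes V :: "'a set"
  assumes "finite_simple_graph V E" "planar_graph V E" "is_cycle V E k C"
  obtains W :: "'a set" and F and \<Phi> :: "(complex set \<times> 'a set set) set" where "facial W F \<Phi>" "F \<subseteq> E"
    "\<And>a b p. \<lbrakk>a \<in> W; b \<in> W; distinct (a # p @ [b]); set p \<inter> W = {};
      path_edges (a # p @ [b]) \<subseteq> E; path_edges (a # p @ [b]) \<inter> F = {}\<rbrakk> \<Longrightarrow> False"
proof -
  obtain pos \<gamma> where "plane_graph V E pos \<gamma>"
    using assms(2) unfolding planar_graph_iff[OF assms(1)] by blast
  then interpret plane_graph V E pos \<gamma> .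
  have fE: "finite E" using finite_V edge(1) by (meson finite_Pow_iff finite_subset PowI subsetI)
  let ?Q = "\<lambda>F. \<exists>W \<Phi>. plane_faces W F \<Phi>"
  obtain vs where "distinct vs" "length vs \<ge> 3" "cycle_edges vs \<subseteq> E"
    using assms(3) by (elim is_cycleE) auto
  then have "?Q (cycle_edges vs)" using plane_faces_cycle by blast
  moreover have "card F < Suc (card E)" if "?Q F" for F
    using that card_mono[OF fE] unfolding plane_faces_def by (meson less_Suc_eq_le)
  ultimately obtain F where F: "?Q F" "\<And>F'. ?Q F' \<Longrightarrow> card F' \<le> card F"
    using ex_has_greatest_nat[of ?Q "cycle_edges vs" card "Suc (card E)"] by (metis less_imp_le)
  then obtain W \<Phi> where pf: "plane_faces W F \<Phi>" by blast
  then have fac: "facial W F \<Phi>" and FE: "F \<subseteq> E" unfolding plane_faces_def by auto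
  show thesis
  proof (rule that[OF fac FE])
    fix a b :: 'a and p
    let ?P = "path_edges (a # p @ [b])"
    assume "a \<in> W" "b \<in> W" "distinct (a # p @ [b])" "set p \<inter> W = {}" "?P \<subseteq> E" and PF: "?P \<inter> F = {}"
    then have "?Q (F \<union> ?P)" using plane_faces_ear[OF pf] by blast
    then have "card (F \<union> ?P) \<le> card F" using F(2) by blast
    then have "?P \<subseteq> F"
      using card_seteq[of "F \<union> ?P" F] FE fE finite_subset[of F E] finite_path_edges[of "a # p @ [b]"] by auto
    moreover have "?P \<noteq> {}" by (cases p) auto
    ultimately show False using PF by blast
  qed
qed

text \<open>Degree at least three makes the conclusion of \<open>shared_corner\<close> impossible,
  so distinct faces never share two edges at a vertex (\<open>corner\<close>). Both discharging
  estimates rest on this. They are stated in doubled form, which keeps them in the natural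
  numbers.\<close>

lemma facial_edge_bound:
  fixes \<Phi> :: "('f \<times> 'a set set) set"
  assumes fac: "facial V E \<Phi>" and e2: "\<And>e. e \<in> E \<Longrightarrow> card e = 2"
    and tri: "\<And>T1 T2. \<lbrakk>is_triangle V E T1; is_triangle V E T2; intersecting_cycles T1 T2\<rbrakk> \<Longrightarrow> T1 = T2"
    and quad: "\<And>T. is_triangle V E T \<Longrightarrow> card {C. is_cycle V E 4 C \<and> adjacent_cycles T C} \<le> 1"
    and deg: "\<And>v. v \<in> V \<Longrightarrow> card {e\<in>E. v \<in> e} \<ge> 3"
  shows "card E + 4 \<le> 2 * card V"
proof -
  interpret facial V E \<Phi> by (rule fac)
  have fin_edge: "finite e" if "e \<in> E" for e
    using e2[OF that] by (intro card_ge_0_finite) simp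
  define d where "d \<phi> = card (snd \<phi>)" for \<phi> :: "'f \<times> 'a set set"
  have cyc: "is_cycle V E (d \<phi>) (snd \<phi>)" "d \<phi> \<ge> 3" if \<phi>: "\<phi> \<in> \<Phi>" for \<phi>
  proof -
    obtain k where k: "is_cycle V E k (snd \<phi>)" using face_cycle[OF \<phi>] by blast
    then have "card (snd \<phi>) = k" "k \<ge> 3" by (auto elim: is_cycleE)
    then show "is_cycle V E (d \<phi>) (snd \<phi>)" "d \<phi> \<ge> 3" using k by (simp_all add: d_def)
  qed
  have corner: False
    if "\<phi> \<in> \<Phi>" "\<psi> \<in> \<Phi>" "\<phi> \<noteq> \<psi>" "x \<noteq> y" "v \<in> x" "v \<in> y" "x \<in> snd \<phi>" "y \<in> snd \<phi>" "x \<in> snd \<psi>" "y \<in> snd \<psi>"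
    for \<phi> \<psi> x y v
  proof -
    have "{e\<in>E. v \<in> e} \<subseteq> {x, y}" using shared_corner[OF that] by blast
    then have "card {e\<in>E. v \<in> e} \<le> card {x, y}" by (intro card_mono) auto
    also have "\<dots> \<le> 2" by (simp add: card_insert_if)
    finally show False using deg[of v] vertices face_subset[OF that(1)] that(5,7) by fastforce
  qed
  have unique: "\<phi> = \<psi>" if pp: "\<phi> \<in> \<Phi>" "\<psi> \<in> \<Phi>" "snd \<phi> = snd \<psi>" for \<phi> \<psi>
  proof (rule ccontr)
    assume ne: "\<phi> \<noteq> \<psi>"
    obtain vs where vs: "distinct vs" "length vs \<ge> 3" "snd \<phi> = cycle_edges vs"
      using cyc[OF pp(1)] by (auto elim: is_cycleE)
    then have "hd vs \<in> set vs" by (cases vs) auto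
    from cycle_at_vertex[OF vs(1,2) this] obtain x y where
      "x \<noteq> y" "x \<in> snd \<phi>" "y \<in> snd \<phi>" "hd vs \<in> x" "hd vs \<in> y" using vs(3) by metis
    then show False using corner[OF pp(1,2) ne, of x y "hd vs"] pp(3) by auto
  qed
  \<comment> \<open>\<open>tri\<close> identifies only the boundaries; \<open>unique\<close> lifts
    this to the faces.\<close>
  have same: "\<phi> = \<psi>" if "\<phi> \<in> \<Phi>" "\<psi> \<in> \<Phi>" "d \<phi> = 3" "d \<psi> = 3" "v \<in> x" "x \<in> snd \<phi>" "v \<in> y" "y \<in> snd \<psi>" for \<phi> \<psi> v x y
  proof -
    have "intersecting_cycles (snd \<phi>) (snd \<psi>)"
      using that(5-8) unfolding intersecting_cycles_def cycle_vertices_def by blast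
    then show ?thesis using that cyc[of \<phi>] cyc[of \<psi>] by (intro unique tri) auto
  qed
  define Tri where "Tri = {\<phi>\<in>\<Phi>. d \<phi> = 3}"
  define Quad where "Quad = {\<phi>\<in>\<Phi>. d \<phi> = 4}"
  define Big where "Big = {\<phi>\<in>\<Phi>. d \<phi> \<ge> 5}"
  have fin: "finite Tri" "finite Quad" "finite Big"
    using finite_faces by (auto simp: Tri_def Quad_def Big_def)
  have fins: "finite (snd \<phi>)" if "\<phi> \<in> \<Phi>" for \<phi>
    using face_subset[OF that] finite_edges finite_subset by blast
  \<comment> \<open>Otherwise two edges of the triangle border other faces, which have length four
    because intersecting triangles are excluded. By \<open>quad\<close> these faces have the same
    boundary, hence are one face. Two edges of a triangle meet, so this face shares a corner with
    the triangle.\<close>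
  have tri_receives: "2 \<le> (\<Sum>f\<in>Big. card (snd t \<inter> snd f))" if "t \<in> Tri" for t
  proof -
    have t: "t \<in> \<Phi>" "d t = 3" using that by (auto simp: Tri_def)
    let ?M = "\<Union>f\<in>Big. snd t \<inter> snd f"
    have "card ?M \<ge> 2"
    proof (rule ccontr)
      assume "\<not> card ?M \<ge> 2"
      moreover have "card (snd t - ?M) = card (snd t) - card ?M"
        using fins[OF t(1)] by (intro card_Diff_subset finite_subset[of ?M "snd t"]) auto
      ultimately have "card (snd t - ?M) \<ge> 2" using t(2) unfolding d_def by linarith
      then obtain e e' where ee: "e \<in> snd t - ?M" "e' \<in> snd t - ?M" "e \<noteq> e'"
        using card_le_Suc0_iff_eq[of "snd t - ?M"] fins[OF t(1)] by fastforce
      have other: "\<exists>g\<in>\<Phi>. g \<noteq> t \<and> x \<in> snd g \<and> d g = 4" if x: "x \<in> snd t - ?M" for x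
      proof -
        have xE: "x \<in> E" using x face_subset[OF t(1)] by blast
        obtain p q where pq: "p \<noteq> q" "{\<rho>\<in>\<Phi>. x \<in> snd \<rho>} = {p, q}" using facial_two[OF fac xE] .
        have "t = p \<or> t = q" using pq(2) t(1) x by blast
        then obtain g where g: "g \<in> \<Phi>" "g \<noteq> t" "x \<in> snd g" using pq by blast
        have "g \<notin> Big" using x g by blast
        moreover have "d g \<noteq> 3"
        proof
          assume g3: "d g = 3"
          have "x \<noteq> {}" using e2[OF xE] by auto
          then show False using same[of t g _ x x] t g g3 x by blast
        qed
        ultimately have "d g = 4" using cyc(2)[OF g(1)] g(1) by (simp add: Big_def)
        then show ?thesis using g by blast
      qed
      obtain g where g: "g \<in> \<Phi>" "g \<noteq> t" "e \<in> snd g" "d g = 4" using other[OF ee(1)] by blast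
      obtain g' where g': "g' \<in> \<Phi>" "g' \<noteq> t" "e' \<in> snd g'" "d g' = 4" using other[OF ee(2)] by blast
      let ?S = "{C. is_cycle V E 4 C \<and> adjacent_cycles (snd t) C}"
      have "?S \<subseteq> Pow E" unfolding is_cycle_def by auto
      then have "finite ?S" using finite_edges finite_subset by auto
      moreover have "card ?S \<le> 1" using quad[of "snd t"] cyc(1)[OF t(1)] t(2) by simp
      moreover have "snd g \<in> ?S" "snd g' \<in> ?S"
        using cyc(1)[OF g(1)] cyc(1)[OF g'(1)] g g' ee unfolding adjacent_cycles_def by auto
      ultimately have "snd g = snd g'" by (metis card_le_Suc0_iff_eq One_nat_def)
      then have gg: "g = g'" using unique g g' by blast
      have "e \<inter> e' \<noteq> {}"
      proof
        assume dis: "e \<inter> e' = {}"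
        obtain vs where vs: "length vs = 3" "\<Union> (snd t) = set vs" using cyc(1)[OF t(1)] t(2) by (auto elim: is_cycleE)
        have eE: "e \<in> E" "e' \<in> E" using ee face_subset[OF t(1)] by auto
        then have "finite e" "finite e'" using fin_edge by auto
        then have "card (e \<union> e') = 4" using dis e2 eE by (simp add: card_Un_disjoint)
        moreover have "card (e \<union> e') \<le> card (set vs)" using ee vs(2) by (intro card_mono) auto
        ultimately show False using vs(1) card_length[of vs] by simp
      qed
      then obtain v where "v \<in> e" "v \<in> e'" by blast
      then show False using corner[of t g e e' v] t g g' gg ee by blast
    qed
    also have "card ?M \<le> (\<Sum>f\<in>Big. card (snd t \<inter> snd f))" using fin by (intro card_UN_le)
    finally show ?thesis .
  qed
  \<comment> \<open>Twice the inequality that one half per edge shared with a triangle does not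
    exceed \<open>d f - 4\<close>. Two such edges that meet would belong to the same triangle by
    \<open>same\<close> and form a forbidden corner; so they are a matching in a cycle of length
    \<open>d f\<close>.\<close>
  have big_gives: "(\<Sum>t\<in>Tri. card (snd t \<inter> snd f)) + 8 \<le> 2 * d f" if "f \<in> Big" for f
  proof -
    have f: "f \<in> \<Phi>" "d f \<ge> 5" using that by (auto simp: Big_def)
    have t: "t \<in> \<Phi>" "d t = 3" "t \<noteq> f" if "t \<in> Tri" for t using that f by (auto simp: Tri_def)
    let ?M = "\<Union>t\<in>Tri. snd t \<inter> snd f"
    have "card ?M = (\<Sum>t\<in>Tri. card (snd t \<inter> snd f))"
    proof (intro card_UN_disjoint fin ballI impI)
      show "finite (snd t \<inter> snd f)" for t using fins[OF f(1)] by simp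
      show "(snd i \<inter> snd f) \<inter> (snd j \<inter> snd f) = {}" if "i \<in> Tri" "j \<in> Tri" "i \<noteq> j" for i j
      proof (rule ccontr)
        assume "\<not> ?thesis"
        then obtain e where e: "e \<in> snd i" "e \<in> snd j" "e \<in> snd f" by blast
        then show False
          using facial_not_three[OF fac _ t(1)[OF that(1)] t(1)[OF that(2)] f(1) e] face_subset[OF f(1)]
            t(3)[OF that(1)] t(3)[OF that(2)] that(3) by blast
      qed
    qed
    moreover have "2 * card ?M \<le> d f"
    proof -
      have ME: "?M \<subseteq> E" using face_subset[OF f(1)] by blast
      have matching: "e \<inter> e' = {}" if ee: "e \<in> ?M" "e' \<in> ?M" "e \<noteq> e'" for e e'
      proof (rule ccontr)
        assume "e \<inter> e' \<noteq> {}"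
        then obtain v where v: "v \<in> e" "v \<in> e'" by blast
        obtain i j where ij: "i \<in> Tri" "j \<in> Tri" "e \<in> snd i" "e' \<in> snd j" "e \<in> snd f" "e' \<in> snd f" using ee by blast
        have "i = j" using same[of i j v e e'] t[OF ij(1)] t[OF ij(2)] v ij by blast
        then show False using corner[of i f e e' v] t[OF ij(1)] f v ij ee(3) by blast
      qed
      have "card (\<Union> ?M) = sum card ?M"
      proof (rule card_Union_disjoint)
        show "pairwise disjnt ?M" using matching unfolding pairwise_def disjnt_def by blast
        show "finite A" if "A \<in> ?M" for A using that ME fin_edge by blast
      qed
      also have "\<dots> = 2 * card ?M" using ME e2 by (subst sum.cong[of ?M ?M card "\<lambda>_. 2"]) auto
      finally have M: "card (\<Union> ?M) = 2 * card ?M" .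
      obtain vs where vs: "length vs = d f" "\<Union> (snd f) = set vs" using cyc(1)[OF f(1)] by (auto elim: is_cycleE)
      have "card (\<Union> ?M) \<le> card (set vs)" using vs(2) by (intro card_mono) auto
      also have "\<dots> \<le> d f" using vs(1) card_length[of vs] by simp
      finally show ?thesis using M by simp
    qed
    \<comment> \<open>Length five is the tight case: a matching there has at most two edges, and 2 +
      8 = 2 * 5.\<close>
    ultimately show ?thesis using f(2) by linarith
  qed
  have "2 * card Tri \<le> (\<Sum>t\<in>Tri. \<Sum>f\<in>Big. card (snd t \<inter> snd f))"
    using sum_mono[of Tri "\<lambda>_. 2" "\<lambda>t. \<Sum>f\<in>Big. card (snd t \<inter> snd f)"] tri_receives by simp
  also have "\<dots> = (\<Sum>f\<in>Big. \<Sum>t\<in>Tri. card (snd t \<inter> snd f))" by (rule sum.swap)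
  finally have "2 * card Tri + 8 * card Big \<le> (\<Sum>f\<in>Big. (\<Sum>t\<in>Tri. card (snd t \<inter> snd f)) + 8)"
    by (simp add: sum.distrib)
  also have "\<dots> \<le> (\<Sum>f\<in>Big. 2 * d f)" using big_gives by (rule sum_mono)
  finally have charge: "card Tri + 4 * card Big \<le> sum d Big" by (simp add: sum_distrib_left[symmetric])
  have part: "\<Phi> = Tri \<union> Quad \<union> Big" "Tri \<inter> Quad = {}" "(Tri \<union> Quad) \<inter> Big = {}"
    using cyc(2) by (force simp: Tri_def Quad_def Big_def)+
  have card\<Phi>: "card \<Phi> = card Tri + card Quad + card Big"
    using fin part(2,3) by (subst part(1)) (simp add: card_Un_disjoint)
  have "sum d \<Phi> = sum d Tri + sum d Quad + sum d Big"
    using fin part(2,3) by (subst part(1)) (simp add: sum.union_disjoint)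
  moreover have "sum d Tri = 3 * card Tri" "sum d Quad = 4 * card Quad"
    by (simp_all add: Tri_def Quad_def)
  moreover have "sum d \<Phi> = 2 * card E"
  proof -
    have "(\<Sum>\<phi>\<in>\<Phi>. card {e\<in>E. e \<in> snd \<phi>}) = 2 * card E"
      using two_faces finite_faces finite_edges by (intro sum_multicount) auto
    moreover have "{e\<in>E. e \<in> snd \<phi>} = snd \<phi>" if "\<phi> \<in> \<Phi>" for \<phi> using face_subset[OF that] by blast
    ultimately show ?thesis by (simp add: d_def)
  qed
  ultimately have "4 * card \<Phi> \<le> 2 * card E" using charge card\<Phi> by linarith
  then show ?thesis using euler by linarith
qed

section \<open>Cycles, paths and the induction over subgraphs\<close>

text \<open>All neighbours of the first vertex of a longest path lie on that path, and a neighbour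
  other than the second vertex closes a cycle.\<close>

lemma ex_cycle:
  assumes "finite V" "V \<noteq> {}" and edge: "\<And>e. e \<in> E \<Longrightarrow> e \<subseteq> V \<and> card e = 2"
    and deg: "\<And>v. v \<in> V \<Longrightarrow> card {e\<in>E. v \<in> e} \<ge> 2"
  shows "\<exists>k C. is_cycle V E k C"
proof -
  let ?Q = "\<lambda>ws. ws \<noteq> [] \<and> distinct ws \<and> set ws \<subseteq> V \<and> path_edges ws \<subseteq> E"
  obtain v where "v \<in> V" using assms by blast
  then have "?Q [v]" by simp
  moreover have "length ws < Suc (card V)" if "?Q ws" for ws
    using that distinct_card[of ws] card_mono[OF assms(1), of "set ws"] by simp
  ultimately obtain ws where ws: "?Q ws" "\<And>ws'. ?Q ws' \<Longrightarrow> length ws' \<le> length ws"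
    using ex_has_greatest_nat[of ?Q "[v]" length "Suc (card V)"] by (metis less_imp_le)
  then obtain x zs where xzs: "ws = x # zs" by (cases ws) auto
  have "x \<in> V" using ws xzs by simp
  \<comment> \<open>For \<open>zs = []\<close> the value \<open>hd zs\<close> is unspecified, but
    degree two still gives an edge other than \<open>{x, hd zs}\<close>, and its other end extends
    the path. So this case needs no separate treatment.\<close>
  then have "\<not> {e\<in>E. x \<in> e} \<subseteq> {{x, hd zs}}"
    using deg[of x] card_mono[of "{{x, hd zs}}" "{e\<in>E. x \<in> e}"] by auto
  then obtain e where e: "e \<in> E" "x \<in> e" "e \<noteq> {x, hd zs}" by blast
  then obtain y where y: "e = {x, y}" "y \<noteq> x" using edge[of e] by (metis card_2_iff insert_iff singletonD doubleton_eq_iff)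
  have "y \<in> V" using e y edge by blast
  have "y \<in> set zs"
  proof (rule ccontr)
    assume "y \<notin> set zs"
    then have "?Q (y # ws)" using ws(1) xzs y e \<open>y \<in> V\<close> by (auto simp: insert_commute)
    then show False using ws(2)[of "y # ws"] by simp
  qed
  then obtain us us' where us: "zs = us @ y # us'" by (meson split_list)
  have "us \<noteq> []" using us e y by auto
  have "path_edges ws = path_edges (x # us @ [y]) \<union> path_edges (y # us')"
    using path_edges_append[of "x # us" y us'] xzs us by simp
  then have "cycle_edges (x # us @ [y]) \<subseteq> E" using cycle_edges_snoc[of x us y] ws(1) e y by auto
  moreover have "distinct (x # us @ [y])" "set (x # us @ [y]) \<subseteq> V" "length (x # us @ [y]) \<ge> 3"
    using ws(1) xzs us \<open>us \<noteq> []\<close> by (auto simp: Suc_le_eq)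
  ultimately show ?thesis unfolding is_cycle_def by blast
qed

text \<open>A walk is cut back whenever it returns to an earlier vertex. The bound on the vertices
  keeps the path inside one component, where it can serve as the interior of an ear.\<close>

lemma rtrancl_path:
  assumes "(x, y) \<in> r\<^sup>*"
  shows "\<exists>ws. ws \<noteq> [] \<and> hd ws = x \<and> last ws = y \<and> distinct ws \<and> set ws \<subseteq> r\<^sup>* `` {x} \<and>
    path_edges ws \<subseteq> {{a, b} | a b. (a, b) \<in> r}"
  using assms
proof (induction rule: rtrancl_induct)
  case base
  show ?case by (intro exI[of _ "[x]"]) auto
next
  case (step y z)
  then obtain ws where ws: "ws \<noteq> []" "hd ws = x" "last ws = y" "distinct ws" "set ws \<subseteq> r\<^sup>* `` {x}"
    "path_edges ws \<subseteq> {{a, b} | a b. (a, b) \<in> r}" by blast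
  show ?case
  proof (cases "z \<in> set ws")
    case True
    then obtain us us' where us: "ws = us @ z # us'" by (meson split_list)
    then have "path_edges (us @ [z]) \<subseteq> path_edges ws" using path_edges_append[of us z us'] by simp
    then show ?thesis using ws us by (intro exI[of _ "us @ [z]"]) (cases us; auto)
  next
    case False
    have "ws @ [z] = butlast ws @ y # [z]" using ws(1,3) by (metis append_butlast_last_id append.assoc append_Cons append_Nil)
    then have "path_edges (ws @ [z]) = path_edges ws \<union> {{y, z}}"
      using path_edges_append[of "butlast ws" y "[z]"] ws(1,3) by (metis append_butlast_last_id path_edges.simps(1) path_edges.simps(3))
    moreover have "(x, z) \<in> r\<^sup>*" using step by (meson rtrancl.rtrancl_into_rtrancl)
    ultimately show ?thesis using ws step(2) False by (intro exI[of _ "ws @ [z]"]) auto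
  qed
qed

text \<open>The hypotheses that every subgraph inherits, so that the edge bound can be proved by
  induction and then applied to each pair counted in \<open>mad\<close>.\<close>

definition admissible :: "'a set \<Rightarrow> 'a set set \<Rightarrow> bool" where
  "admissible V E \<longleftrightarrow> finite_simple_graph V E \<and> planar_graph V E \<and>
    (\<forall>T1 T2. is_triangle V E T1 \<and> is_triangle V E T2 \<and> T1 \<noteq> T2 \<longrightarrow> \<not> intersecting_cycles T1 T2) \<and>
    (\<forall>T. is_triangle V E T \<longrightarrow> card {C. is_cycle V E 4 C \<and> adjacent_cycles T C} \<le> 1)"

lemma admissible_facts:
  assumes "admissible V E"
  shows "finite V" "finite E" "\<And>e. e \<in> E \<Longrightarrow> e \<subseteq> V" "\<And>e. e \<in> E \<Longrightarrow> card e = 2"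
proof -
  show *: "finite V" "\<And>e. e \<in> E \<Longrightarrow> e \<subseteq> V" "\<And>e. e \<in> E \<Longrightarrow> card e = 2"
    using assms unfolding admissible_def finite_simple_graph_def by auto
  then show "finite E" by (meson finite_Pow_iff finite_subset PowI subsetI)
qed

text \<open>Cycles are edge sets, so those of the subgraph are among those of the whole graph and
  both conditions on triangles restrict. So does the drawing.\<close>

lemma admissible_subgraph:
  assumes "admissible V E" "V' \<subseteq> V" "E' \<subseteq> E" "\<And>e. e \<in> E' \<Longrightarrow> e \<subseteq> V'"
  shows "admissible V' E'"
proof -
  have sub: "is_cycle V' E' k C \<Longrightarrow> is_cycle V E k C" for k C using is_cycle_mono assms by metis
  have fsg: "finite_simple_graph V' E'"
    using assms unfolding admissible_def finite_simple_graph_def by (meson finite_subset subsetD)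
  have pl: "planar_graph V' E'"
  proof -
    have "finite_simple_graph V E" "planar_graph V E" using assms(1) unfolding admissible_def by auto
    then obtain pos \<gamma> where "plane_graph V E pos \<gamma>" using planar_graph_iff by blast
    then have "plane_graph V' E' pos \<gamma>" using plane_graph.plane_subgraph assms(2-4) by blast
    then show ?thesis using planar_graph_iff[OF fsg] by blast
  qed
  have quad: "card {C. is_cycle V' E' 4 C \<and> adjacent_cycles T C} \<le> 1" if "is_triangle V' E' T" for T
  proof -
    let ?S = "{C. is_cycle V E 4 C \<and> adjacent_cycles T C}"
    have "?S \<subseteq> Pow E" unfolding is_cycle_def by auto
    \<comment> \<open>Comparing cardinalities needs a finite larger set, as \<open>card\<close> of
      an infinite set is 0.\<close>
    then have "finite ?S" using admissible_facts(2)[OF assms(1)] finite_subset by auto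
    then have "card {C. is_cycle V' E' 4 C \<and> adjacent_cycles T C} \<le> card ?S"
      using sub by (intro card_mono) auto
    also have "\<dots> \<le> 1" using assms(1) sub[OF that] unfolding admissible_def by blast
    finally show ?thesis .
  qed
  have "\<not> intersecting_cycles T1 T2" if "is_triangle V' E' T1" "is_triangle V' E' T2" "T1 \<noteq> T2" for T1 T2
    using assms(1) sub[OF that(1)] sub[OF that(2)] that(3) unfolding admissible_def by blast
  then show ?thesis using fsg pl quad unfolding admissible_def by blast
qed

lemma admissible_edge_bound:
  assumes "admissible V E" "card V \<ge> 2"
  shows "card E + 3 \<le> 2 * card V"
  using assms
proof (induction "card V" arbitrary: V E rule: less_induct)
  case less
  note adm = less.prems(1)
  note af = admissible_facts[OF adm]
  show ?case
  proof (cases "\<exists>v\<in>V. card {e\<in>E. v \<in> e} \<le> 2")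
    case True
    then obtain v where v: "v \<in> V" "card {e\<in>E. v \<in> e} \<le> 2" by blast
    show ?thesis
    proof (cases "card V = 2")
      case True
      have "e = V" if "e \<in> E" for e using card_subset_eq[OF af(1) af(3)[OF that]] af(4)[OF that] True by simp
      then have "E \<subseteq> {V}" by blast
      then have "card E \<le> 1" using card_mono[of "{V}" E] by simp
      then show ?thesis using True by simp
    next
      case False
      let ?V = "V - {v}" and ?E = "{e\<in>E. v \<notin> e}"
      have "admissible ?V ?E" using af by (intro admissible_subgraph[OF adm]) auto
      moreover have cV: "card ?V = card V - 1" using v af(1) by simp
      ultimately have "card ?E + 3 \<le> 2 * card ?V"
        using less.hyps[of ?V ?E] less.prems(2) False by simp
      moreover have "card E = card {e\<in>E. v \<in> e} + card ?E"
      proof -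
        have "E = {e\<in>E. v \<in> e} \<union> ?E" by blast
        then show ?thesis using card_Un_disjoint[of "{e\<in>E. v \<in> e}" ?E] af(2) by auto
      qed
      ultimately show ?thesis using v(2) cV less.prems(2) by linarith
    qed
  next
    case False
    then have deg: "card {e\<in>E. v \<in> e} \<ge> 3" if "v \<in> V" for v using that by force
    have "V \<noteq> {}" using less.prems(2) by auto
    have deg2: "card {e\<in>E. v \<in> e} \<ge> 2" if "v \<in> V" for v using deg[OF that] by simp
    obtain k C where cy: "is_cycle V E k C"
      using ex_cycle[OF af(1) \<open>V \<noteq> {}\<close> conjI[OF af(3) af(4)] deg2] by blast
    have fp: "finite_simple_graph V E" "planar_graph V E" using adm unfolding admissible_def by auto
    obtain W F and \<Phi> :: "(complex set \<times> 'a set set) set" where fac: "facial W F \<Phi>" and FE: "F \<subseteq> E"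
      and no_ear: "\<And>a b p. \<lbrakk>a \<in> W; b \<in> W; distinct (a # p @ [b]); set p \<inter> W = {};
        path_edges (a # p @ [b]) \<subseteq> E; path_edges (a # p @ [b]) \<inter> F = {}\<rbrakk> \<Longrightarrow> False"
      by (rule planar_facial[OF fp cy], rule that, assumption, assumption, blast)
    interpret facial W F \<Phi> by (rule fac)
    have WV: "W \<subseteq> V" using vertices FE af(3) by blast
    show ?thesis
    proof (cases "W = V")
      case True
      have "E \<subseteq> F"
      proof (rule ccontr)
        assume "\<not> E \<subseteq> F"
        then obtain e where e: "e \<in> E" "e \<notin> F" by blast
        then obtain a b where ab: "e = {a, b}" "a \<noteq> b" using af(4) by (meson card_2_iff)
        \<comment> \<open>A missing edge is an ear with empty interior.\<close>
        then show False using no_ear[of a b "[]"] e af(3)[OF e(1)] True by auto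
      qed
      then have "facial V E \<Phi>" using fac FE True by simp
      then have "card E + 4 \<le> 2 * card V"
      proof (rule facial_edge_bound[OF _ af(4) _ _ deg])
        show "T1 = T2" if "is_triangle V E T1" "is_triangle V E T2" "intersecting_cycles T1 T2" for T1 T2
          using adm that unfolding admissible_def by metis
        show "card {C. is_cycle V E 4 C \<and> adjacent_cycles T C} \<le> 1" if "is_triangle V E T" for T
          using adm that unfolding admissible_def by simp
      qed
      then show ?thesis by simp
    next
      case False
      then obtain v0 where v0: "v0 \<in> V" "v0 \<notin> W" using WV by blast
      \<comment> \<open>\<open>K\<close> will be the component of \<open>v0\<close> in the graph
        outside \<open>W\<close>, and \<open>N\<close> the set of its attachments in
        \<open>W\<close>.\<close>
      define r where "r = {(x, y). {x, y} \<in> E \<and> x \<notin> W \<and> y \<notin> W}"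
      define K where "K = r\<^sup>* `` {v0}"
      have "sym r" by (auto simp: r_def sym_def insert_commute)
      have KV: "k \<in> V - W" if "k \<in> K" for k
      proof -
        have "(v0, k) \<in> r\<^sup>*" using that by (simp add: K_def)
        then show ?thesis using v0 by (induction rule: rtrancl_induct) (use af(3) in \<open>auto simp: r_def\<close>)
      qed
      define N where "N = {u\<in>W. \<exists>k\<in>K. {u, k} \<in> E}"
      \<comment> \<open>Two attachments would be joined by a path through \<open>K\<close>. Each of
        its edges has an end outside \<open>W\<close>, hence is not in \<open>F\<close>, so the path
        would be an ear.\<close>
      have Nuniq: "u = w" if "u \<in> N" "w \<in> N" for u w
      proof (rule ccontr)
        assume "u \<noteq> w"
        obtain k1 k2 where k: "k1 \<in> K" "k2 \<in> K" "{u, k1} \<in> E" "{w, k2} \<in> E" using \<open>u \<in> N\<close> \<open>w \<in> N\<close> by (auto simp: N_def)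
        have uw: "u \<in> W" "w \<in> W" using that by (auto simp: N_def)
        have "(v0, k1) \<in> r\<^sup>*" using k(1) by (simp add: K_def)
        then have "(k1, v0) \<in> r\<^sup>*" by (rule symD[OF sym_rtrancl[OF \<open>sym r\<close>]])
        moreover have "(v0, k2) \<in> r\<^sup>*" using k(2) by (simp add: K_def)
        ultimately have "(k1, k2) \<in> r\<^sup>*" by (rule rtrancl_trans)
        then obtain ws where ws: "ws \<noteq> []" "hd ws = k1" "last ws = k2" "distinct ws" "set ws \<subseteq> r\<^sup>* `` {k1}"
          "path_edges ws \<subseteq> {{a, b} | a b. (a, b) \<in> r}" using rtrancl_path[of k1 k2 r] by blast
        have "r\<^sup>* `` {k1} \<subseteq> K" using k(1) by (auto simp: K_def intro: rtrancl_trans)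
        then have wsK: "set ws \<subseteq> V - W" using ws(5) KV by blast
        have "path_edges (u # ws @ [w]) = insert {u, k1} (path_edges (ws @ [w]))"
          using ws(1,2) by (cases ws) auto
        also have "path_edges (ws @ [w]) = path_edges ws \<union> {{k2, w}}"
          using path_edges_append[of "butlast ws" k2 "[w]"] ws(1,3)
          by (metis append_butlast_last_id append.assoc append_Cons append_Nil path_edges.simps(1) path_edges.simps(3))
        finally have P: "path_edges (u # ws @ [w]) = insert {u, k1} (insert {w, k2} (path_edges ws))"
          by (auto simp: insert_commute)
        have "e \<in> E \<and> \<not> e \<subseteq> W" if "e \<in> path_edges (u # ws @ [w])" for e
          using that P ws(6) k KV by (auto simp: r_def)
        then have "path_edges (u # ws @ [w]) \<subseteq> E" "path_edges (u # ws @ [w]) \<inter> F = {}"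
          using vertices by blast+
        moreover have "distinct (u # ws @ [w])" "set ws \<inter> W = {}" using ws(4) wsK uw \<open>u \<noteq> w\<close> by auto
        ultimately show False using no_ear[of u w ws] uw by blast
      qed
      note W3 = card_vertices_ge_3
      \<comment> \<open>If \<open>K\<close> has no attachment, any vertex of \<open>W\<close> serves
        as cut vertex; this covers disconnected graphs too.\<close>
      obtain u where u: "u \<in> W" "N \<subseteq> {u}"
      proof (cases "N = {}")
        case True
        obtain u where "u \<in> W" using W3 by fastforce
        then show thesis using that True by blast
      next
        case False
        then show thesis using that Nuniq by (auto simp: N_def)
      qed
      \<comment> \<open>The parts overlap only in \<open>u\<close>. Since \<open>W\<close> has at
        least three vertices and \<open>K\<close> at least one, both parts are smaller than
        \<open>V\<close> and have at least two vertices, as the induction hypothesis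
        demands.\<close>
      let ?V1 = "insert u K" and ?V2 = "V - K"
      have v0K: "v0 \<in> K" by (simp add: K_def)
      have KsubV: "K \<subseteq> V - W" using KV by blast
      have fK: "finite K" using KsubV af(1) finite_subset by blast
      have uK: "u \<notin> K" using u KsubV by blast
      have c1: "card ?V1 = card K + 1" using fK uK by simp
      have c2: "card ?V2 = card V - card K" using KsubV fK by (intro card_Diff_subset) auto
      have cK: "card K \<ge> 1" using v0K fK by (metis card_0_eq empty_iff less_one not_le)
      have cKW: "card K + card W \<le> card V"
      proof -
        have "K \<inter> W = {}" "K \<union> W \<subseteq> V" using KsubV WV by auto
        then show ?thesis
          using card_mono[OF af(1), of "K \<union> W"] card_Un_disjoint[OF fK finite_vertices] by simp
      qed
      let ?E1 = "{e\<in>E. e \<subseteq> ?V1}" and ?E2 = "{e\<in>E. e \<subseteq> ?V2}"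
      have cover: "E \<subseteq> ?E1 \<union> ?E2"
      proof
        fix e assume e: "e \<in> E"
        show "e \<in> ?E1 \<union> ?E2"
        proof (cases "e \<inter> K = {}")
          case True then show ?thesis using e af(3)[OF e] by blast
        next
          case False
          then obtain x where x: "x \<in> e" "x \<in> K" by blast
          obtain p q where "e = {p, q}" using af(4)[OF e] by (meson card_2_iff)
          then have "e = {x, q} \<or> e = {x, p}" using x(1) by (auto simp: insert_commute)
          then obtain y where y: "e = {x, y}" by blast
          have "y \<in> ?V1"
          proof (cases "y \<in> W")
            case True
            then have "y \<in> N" using x e y by (auto simp: N_def insert_commute)
            then show ?thesis using u by blast
          next
            case False
            then have "(x, y) \<in> r" using e y x KV by (auto simp: r_def)
            then show ?thesis using x by (auto simp: K_def intro: rtrancl_into_rtrancl)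
          qed
          then show ?thesis using e x y by auto
        qed
      qed
      have "admissible ?V1 ?E1" using u WV KsubV by (intro admissible_subgraph[OF adm]) auto
      then have b1: "card ?E1 + 3 \<le> 2 * card ?V1" using less.hyps[of ?V1 ?E1] c1 cK cKW W3 by simp
      have "admissible ?V2 ?E2" by (intro admissible_subgraph[OF adm]) auto
      then have b2: "card ?E2 + 3 \<le> 2 * card ?V2" using less.hyps[of ?V2 ?E2] c2 cK cKW W3 by simp
      have "card E \<le> card (?E1 \<union> ?E2)" using cover af(2) by (intro card_mono) auto
      also have "\<dots> \<le> card ?E1 + card ?E2" by (rule card_Un_le)
      \<comment> \<open>The sizes of the parts add up to \<open>card V + 1\<close>, so the two
        bounds give \<open>2 * card V - 4\<close>, one better than required.\<close>
      finally show ?thesis using b1 b2 c1 c2 cKW by linarith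
    qed
  qed
qed

theorem theorem2:
  fixes V :: "'a set" and E :: "'a set set"
  assumes "finite_simple_graph V E"
    and "V \<noteq> {}"
    and "planar_graph V E"
    and "\<forall>T1 T2. is_triangle V E T1 \<and> is_triangle V E T2 \<and> T1 \<noteq> T2
                 \<longrightarrow> \<not> intersecting_cycles T1 T2"
    and "\<forall>T. is_triangle V E T \<longrightarrow>
                 card {C. is_cycle V E 4 C \<and> adjacent_cycles T C} \<le> 1"
  shows "mad V E < 4"
proof -
  have adm: "admissible V E" unfolding admissible_def using assms by blast
  note af = admissible_facts[OF adm]
  let ?S = "{2 * real (card F) / real (card W) | W F. W \<subseteq> V \<and> W \<noteq> {} \<and> F \<subseteq> E \<and> (\<forall>e\<in>F. e \<subseteq> W)}"
  have "?S \<subseteq> (\<lambda>(W, F). 2 * real (card F) / real (card W)) ` (Pow V \<times> Pow E)" by auto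
  then have fin: "finite ?S" by (rule finite_subset) (use af in auto)
  \<comment> \<open>The edgeless graph on \<open>V\<close> shows that the maximum is taken over a
    nonempty set.\<close>
  have mem: "2 * real (card ({} :: 'a set set)) / real (card V) \<in> ?S"
    by (intro CollectI exI[of _ V] exI[of _ "{}"]) (use assms(2) in auto)
  have less4: "x < 4" if x: "x \<in> ?S" for x
  proof -
    obtain W F where WF: "x = 2 * real (card F) / real (card W)" "W \<subseteq> V" "W \<noteq> {}" "F \<subseteq> E" "\<forall>e\<in>F. e \<subseteq> W"
      using x by blast
    have W1: "card W \<ge> 1" using WF af(1) by (metis card_0_eq finite_subset less_one not_le)
    \<comment> \<open>A single vertex lies outside the range of
      \<open>admissible_edge_bound\<close>, as 2 * 1 - 3 is negative, but it carries no
      edge.\<close>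
    have "card F < 2 * card W"
    proof (cases "card W \<ge> 2")
      case True
      then show ?thesis using admissible_edge_bound[OF admissible_subgraph[OF adm WF(2,4)]] WF(5) by force
    next
      case False
      have "F = {}"
      proof (rule ccontr)
        assume "F \<noteq> {}"
        then obtain e where "e \<in> F" by blast
        then have "card e = 2" "card e \<le> card W"
          using WF af finite_subset[of W V] by (auto intro: card_mono)
        then show False using False by simp
      qed
      then show ?thesis using W1 by simp
    qed
    then have "2 * real (card F) < 4 * real (card W)" by linarith
    then show ?thesis using WF(1) W1 by (simp add: divide_less_eq)
  qed
  show ?thesis unfolding mad_def
  proof (rule less4, rule Max_in[OF fin])
    show "?S \<noteq> {}" using mem by (metis empty_iff)
  qed
qed

end
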